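(* Let $\varepsilon>0$. There exists a constant $c_\varepsilon>0$, depending only on $\varepsilon$, such that for all $N\ge2$ and all parameters $p_1,\dots,p_N$ with $\varepsilon\le p_i\le1-\varepsilon$ for $i=1,\dots,N$, the exclusion process with site disorder satisfies $$\bar\lambda(N)\ge c_\varepsilon .$$
   Context: Exclusion process with site disorder. Let $p_1,\dots,p_N\in(0,1)$ and let $\mu_i$ be the Bernoulli law on $\{0,1\}$ with $\mu_i(\eta_i=1)=p_i$, $\mu_i(\eta_i=0)=1-p_i$. For an integer $\omega\in\{0,1,\dots,N\}$ let $\Omega_{N,\omega}=\{\eta\in\{0,1\}^N:\ \sum_{i=1}^N\eta_i=\omega\}$ and let $\nu=\nu_{N,\omega}$ be the product measure $\mu_1\times\cdots\times\mu_N$ conditioned on $\Omega_{N,\omega}$. The generator is $$\mathcal{L}f(\eta)=\frac1N\sum_b\bigl[\nu(f\mid\mathcal{F}_b)(\eta)-f(\eta)\bigr]=\frac1N\sum_b c_b(\eta)\bigl(f(\eta^b)-f(\eta)\bigr),$$ where the sum is over all unordered pairs $b=\{i,j\}$ of distinct indices in $\{1,\dots,N\}$, $\mathcal{F}_b$ is the $\sigma$-algebra generated by $\eta_\ell$, $\ell\notin b$, $\eta^b$ is the configuration $\eta$ with $\eta_i$ and $\eta_j$ exchanged, and $$c_b(\eta)=\frac{p_i(1-p_j)\,\eta_j(1-\eta_i)+p_j(1-p_i)\,\eta_i(1-\eta_j)}{p_i(1-p_j)+p_j(1-p_i)} .$$ The spectral gap is $$\lambda(N,\omega)=\inf\left\{\frac{\nu(f(-\mathcal{L})f)}{\nu(f^2)}:\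 f:\Omega_{N,\omega}\to\mathbb{R},\ f\neq0,\ \nu(f)=0\right\},$$ with the convention $\lambda(N,0)=\lambda(N,N)=+\infty$, and $\bar\lambda(N)=\min_{\omega\in\{0,\dots,N\}}\lambda(N,\omega)$. *)

theory Defs
  imports "HOL-Probability.Probability" "HOL-Combinatorics.Transposition"
begin

text \<open>
  The sites are \<open>1, \<dots>, N\<close>, and \<^term>\<open>True\<close> marks an occupied site. Elements of
  \<open>{0,1}\<^sup>N\<close> are total functions \<^typ>\<open>nat \<Rightarrow> bool\<close> forced to be \<^term>\<open>False\<close> off the sites.
\<close>

definition config_space :: "nat \<Rightarrow> nat \<Rightarrow> (nat \<Rightarrow> bool) set" where
  "config_space N w =
     {\<eta> \<in> PiE_dflt {1..N} False (\<lambda>_. UNIV). (\<Sum>i=1..N. of_bool (\<eta> i)) = w}"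

definition cond_product :: "nat \<Rightarrow> (nat \<Rightarrow> real) \<Rightarrow> nat \<Rightarrow> (nat \<Rightarrow> bool) pmf" where
  "cond_product N p w =
     cond_pmf (Pi_pmf {1..N} False (\<lambda>i. bernoulli_pmf (p i))) (config_space N w)"

definition exchange :: "nat \<Rightarrow> nat \<Rightarrow> (nat \<Rightarrow> bool) \<Rightarrow> (nat \<Rightarrow> bool)" where
  "exchange i j \<eta> = \<eta> \<circ> Transposition.transpose i j"

definition exchange_rate :: "(nat \<Rightarrow> real) \<Rightarrow> nat \<Rightarrow> nat \<Rightarrow> (nat \<Rightarrow> bool) \<Rightarrow> real" where
  "exchange_rate p i j \<eta> =
     (p i * (1 - p j) * of_bool (\<eta> j) * (1 - of_bool (\<eta> i)) +
      p j * (1 - p i) * of_bool (\<eta> i) * (1 - of_bool (\<eta> j))) /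
     (p i * (1 - p j) + p j * (1 - p i))"

text \<open>
  An unordered pair \<open>b = {i, j}\<close> is represented by its increasing enumeration. The lemma
  \<open>generator_eq_real_cond_exp\<close> below gives the equivalent expression through the conditional
  expectations \<open>\<nu>(f | \<F>\<^sub>b)\<close>.
\<close>

definition generator ::
    "nat \<Rightarrow> (nat \<Rightarrow> real) \<Rightarrow> ((nat \<Rightarrow> bool) \<Rightarrow> real) \<Rightarrow> (nat \<Rightarrow> bool) \<Rightarrow> real" where
  "generator N p f \<eta> =
     1 / real N * (\<Sum>(i, j) \<in> {(i, j). 1 \<le> i \<and> i < j \<and> j \<le> N}.
       exchange_rate p i j \<eta> * (f (exchange i j \<eta>) - f \<eta>))"

text \<open>
  Test functions are total, but only their values on \<open>config_space N w\<close> enter, since this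
  set is invariant under exchanges and carries the measure. Hence \<open>f \<noteq> 0\<close> has to be read on
  \<open>config_space N w\<close>.
\<close>

definition spectral_gap :: "nat \<Rightarrow> (nat \<Rightarrow> real) \<Rightarrow> nat \<Rightarrow> ereal" where
  "spectral_gap N p w =
     (if w = 0 \<or> w = N then \<infinity>
      else Inf {ereal (measure_pmf.expectation (cond_product N p w) (\<lambda>\<eta>. f \<eta> * (- generator N p f \<eta>)) /
                       measure_pmf.expectation (cond_product N p w) (\<lambda>\<eta>. (f \<eta>)\<^sup>2)) | f.
                (\<exists>\<eta> \<in> config_space N w. f \<eta> \<noteq> 0) \<and>
                measure_pmf.expectation (cond_product N p w) f = 0})"

definition min_spectral_gap :: "nat \<Rightarrow> (nat \<Rightarrow> real) \<Rightarrow> ereal" where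
  "min_spectral_gap N p = (MIN w \<in> {0..N}. spectral_gap N p w)"


section \<open>The generator through conditional expectations\<close>

definition sites_algebra :: "nat \<Rightarrow> nat set \<Rightarrow> (nat \<Rightarrow> bool) measure" where
  "sites_algebra N b =
     sigma UNIV {{\<eta>. \<eta> l = v} | l v. l \<in> {1..N} - b}"

lemma finite_config_space: "finite (config_space N w)"
proof -
  have "finite (PiE_dflt {1..N} False (\<lambda>_. UNIV :: bool set))"
    by (intro finite_PiE_dflt) auto
  then show ?thesis
    by (rule rev_finite_subset) (auto simp: config_space_def)
qed

lemma exchange_exchange [simp]: "exchange i j (exchange i j \<eta>) = \<eta>"
  by (simp add: exchange_def fun_eq_iff)

lemma exchange_in_config_space:
  assumes "i \<in> {1..N}" "j \<in> {1..N}" "\<eta> \<in> config_space N w"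
  shows "exchange i j \<eta> \<in> config_space N w"
proof -
  have b: "bij_betw (Transposition.transpose i j) {1..N} {1..N}"
    using assms(1,2) by (simp add: bij_betw_transpose_iff)
  have "(\<Sum>l=1..N. of_bool (\<eta> (Transposition.transpose i j l)) :: nat) = (\<Sum>l=1..N. of_bool (\<eta> l))"
    by (rule sum.reindex_bij_betw[OF b])
  moreover have "\<not> \<eta> (Transposition.transpose i j l)" if "l \<notin> {1..N}" for l
  proof -
    have "Transposition.transpose i j l = l"
      using that assms(1,2) by (metis transpose_apply_other)
    then show ?thesis
      using that assms(3) by (auto simp: config_space_def PiE_dflt_def)
  qed
  ultimately show ?thesis
    using assms(3) by (auto simp: config_space_def PiE_dflt_def exchange_def o_def simp del: sum_of_bool_eq)
qed

context
  fixes N w :: nat and p :: "nat \<Rightarrow> real"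
  assumes w: "w \<le> N" and p: "\<And>i. i \<in> {1..N} \<Longrightarrow> 0 < p i \<and> p i < 1"
begin

lemma pmf_product_pos:
  assumes "\<eta> \<in> config_space N w"
  shows "pmf (Pi_pmf {1..N} False (\<lambda>i. bernoulli_pmf (p i))) \<eta> > 0"
proof -
  have "pmf (Pi_pmf {1..N} False (\<lambda>i. bernoulli_pmf (p i))) \<eta> =
        (\<Prod>i=1..N. pmf (bernoulli_pmf (p i)) (\<eta> i))"
    using assms by (intro pmf_Pi') (auto simp: config_space_def PiE_dflt_def)
  also have "\<dots> > 0"
  proof (intro prod_pos)
    fix i assume "i \<in> {1..N}"
    then show "0 < pmf (bernoulli_pmf (p i)) (\<eta> i)"
      using p[of i] by (cases "\<eta> i") auto
  qed
  finally show ?thesis .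
qed

lemma set_product_Int_config_space:
  "set_pmf (Pi_pmf {1..N} False (\<lambda>i. bernoulli_pmf (p i))) \<inter> config_space N w \<noteq> {}"
proof -
  have "{1..N} \<inter> {i. 1 \<le> i \<and> i \<le> w} = {1..w}" using w by auto
  then have "(\<lambda>i. 1 \<le> i \<and> i \<le> w) \<in> config_space N w"
    using w by (auto simp: config_space_def PiE_dflt_def of_bool_def sum.If_cases)
  moreover have "(\<lambda>i. 1 \<le> i \<and> i \<le> w) \<in> set_pmf (Pi_pmf {1..N} False (\<lambda>i. bernoulli_pmf (p i)))"
    using pmf_product_pos[OF calculation] unfolding set_pmf_iff by linarith
  ultimately show ?thesis by blast
qed

lemma set_cond_product: "set_pmf (cond_product N p w) = config_space N w"
  unfolding cond_product_def set_cond_pmf[OF set_product_Int_config_space]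
  using pmf_product_pos by (force simp: set_pmf_iff)

lemma detailed_balance:
  assumes ij: "i \<in> {1..N}" "j \<in> {1..N}" "i \<noteq> j" and \<eta>: "\<eta> \<in> config_space N w"
  shows "pmf (cond_product N p w) (exchange i j \<eta>) * exchange_rate p i j (exchange i j \<eta>) =
         pmf (cond_product N p w) \<eta> * exchange_rate p i j \<eta>"
proof -
  let ?B = "\<lambda>l. pmf (bernoulli_pmf (p l))"
  let ?P = "pmf (Pi_pmf {1..N} False (\<lambda>i. bernoulli_pmf (p i)))"
  have P: "?P \<xi> = ?B i (\<xi> i) * ?B j (\<xi> j) * (\<Prod>l\<in>{1..N} - {i} - {j}. ?B l (\<xi> l))"
    if "\<xi> \<in> config_space N w" for \<xi>
  proof -
    have "?P \<xi> = (\<Prod>l=1..N. ?B l (\<xi> l))"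
      using that by (intro pmf_Pi') (auto simp: config_space_def PiE_dflt_def)
    also have "\<dots> = ?B i (\<xi> i) * (\<Prod>l\<in>{1..N} - {i}. ?B l (\<xi> l))"
      using ij by (intro prod.remove) auto
    also have "(\<Prod>l\<in>{1..N} - {i}. ?B l (\<xi> l)) = ?B j (\<xi> j) * (\<Prod>l\<in>{1..N} - {i} - {j}. ?B l (\<xi> l))"
      using ij by (intro prod.remove) auto
    finally show ?thesis by simp
  qed
  have \<eta>': "exchange i j \<eta> \<in> config_space N w"
    using ij \<eta> by (intro exchange_in_config_space)
  have R: "(\<Prod>l\<in>{1..N} - {i} - {j}. ?B l (exchange i j \<eta> l)) = (\<Prod>l\<in>{1..N} - {i} - {j}. ?B l (\<eta> l))"
    by (intro prod.cong) (auto simp: exchange_def)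
  have "?P (exchange i j \<eta>) * exchange_rate p i j (exchange i j \<eta>) = ?P \<eta> * exchange_rate p i j \<eta>"
    unfolding P[OF \<eta>] P[OF \<eta>'] R
    using p[OF ij(1)] p[OF ij(2)]
    by (cases "\<eta> i"; cases "\<eta> j") (auto simp: exchange_def exchange_rate_def)
  then show ?thesis
    unfolding cond_product_def pmf_cond[OF set_product_Int_config_space] using \<eta> \<eta>' by simp
qed

lemma real_cond_exp_pair:
  assumes ij: "i \<in> {1..N}" "j \<in> {1..N}" "i \<noteq> j" and \<eta>: "\<eta> \<in> config_space N w"
  shows "real_cond_exp (cond_product N p w) (sites_algebra N {i, j}) f \<eta> - f \<eta> =
         exchange_rate p i j \<eta> * (f (exchange i j \<eta>) - f \<eta>)"
proof -
  let ?M = "measure_pmf (cond_product N p w)" and ?F = "sites_algebra N {i, j}"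
  let ?C = "config_space N w"
  define D where "D = {1..N} - {i, j}"
  define g where "g \<xi> = f \<xi> + exchange_rate p i j \<xi> * (f (exchange i j \<xi>) - f \<xi>)" for \<xi>
  define agree where "agree \<xi> \<zeta> \<longleftrightarrow> (\<forall>l\<in>D. \<xi> l = \<zeta> l)" for \<xi> \<zeta> :: "nat \<Rightarrow> bool"
  define h where "h \<xi> = (\<Sum>\<zeta>\<in>?C. g \<zeta> * of_bool (agree \<xi> \<zeta>)) / (\<Sum>\<zeta>\<in>?C. of_bool (agree \<xi> \<zeta>))" for \<xi>
  have space_F: "space ?F = UNIV"
    by (simp add: sites_algebra_def)
  have site: "{\<xi>. \<xi> l = v} \<in> sets ?F" if "l \<in> D" for l v
    using that by (auto simp: sites_algebra_def D_def)
  have agree_sets: "{\<xi>. agree \<xi> \<zeta>} \<in> sets ?F" for \<zeta>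
  proof -
    have "{\<xi> \<in> space ?F. \<forall>l\<in>D. \<xi> l = \<zeta> l} \<in> sets ?F"
      using site by (intro sets.sets_Collect_finite_All) (auto simp: space_F D_def)
    then show ?thesis by (simp add: agree_def space_F)
  qed
  have h_meas: "h \<in> borel_measurable ?F"
  proof -
    have "(\<lambda>\<xi>. of_bool (agree \<xi> \<zeta>) :: real) \<in> borel_measurable ?F" for \<zeta>
    proof -
      have "(\<lambda>\<xi>. of_bool (agree \<xi> \<zeta>) :: real) = indicator {\<xi>. agree \<xi> \<zeta>}"
        by (auto simp: indicator_def fun_eq_iff)
      then show ?thesis using agree_sets by simp
    qed
    then show ?thesis unfolding h_def by measurable
  qed
  have sum_split: "(\<Sum>l=1..N. of_bool (\<xi> l)) = (of_bool (\<xi> i) + of_bool (\<xi> j) + (\<Sum>l\<in>D. of_bool (\<xi> l)) :: nat)"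
    for \<xi>
  proof -
    have "{1..N} = insert i (insert j D)" using ij by (auto simp: D_def)
    moreover have "finite D" "i \<notin> insert j D" "j \<notin> D" using ij by (auto simp: D_def)
    ultimately show ?thesis by (simp del: sum_of_bool_eq)
  qed
  have agree_cases: "\<zeta> = \<xi> \<or> \<zeta> = exchange i j \<xi>"
    if "\<xi> \<in> ?C" "\<zeta> \<in> ?C" "agree \<xi> \<zeta>" for \<xi> \<zeta>
  proof -
    have out: "\<xi> l = \<zeta> l" if "l \<noteq> i" "l \<noteq> j" for l
      using \<open>\<xi> \<in> ?C\<close> \<open>\<zeta> \<in> ?C\<close> \<open>agree \<xi> \<zeta>\<close> that
      by (cases "l \<in> {1..N}") (auto simp: agree_def D_def config_space_def PiE_dflt_def)
    have "(\<Sum>l\<in>D. of_bool (\<xi> l) :: nat) = (\<Sum>l\<in>D. of_bool (\<zeta> l))"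
      using that(3) by (intro sum.cong) (auto simp: agree_def)
    then have s: "of_bool (\<xi> i) + of_bool (\<xi> j) = (of_bool (\<zeta> i) + of_bool (\<zeta> j) :: nat)"
      using that(1,2) sum_split[of \<xi>] sum_split[of \<zeta>] by (auto simp: config_space_def)
    then consider "\<xi> i = \<zeta> i" "\<xi> j = \<zeta> j" | "\<xi> i = \<zeta> j" "\<xi> j = \<zeta> i"
      by (cases "\<xi> i"; cases "\<xi> j"; cases "\<zeta> i"; cases "\<zeta> j") auto
    then show ?thesis
    proof cases
      case 1
      then have "\<zeta> = \<xi>" using out by (intro ext) metis
      then show ?thesis ..
    next
      case 2
      then have "\<zeta> = exchange i j \<xi>"
        using out by (auto simp: exchange_def fun_eq_iff Transposition.transpose_def)
      then show ?thesis ..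
    qed
  qed
  have g_exchange: "g (exchange i j \<xi>) = g \<xi>" for \<xi>
  proof -
    have den: "p i * (1 - p j) + p j * (1 - p i) > 0"
      using p[OF ij(1)] p[OF ij(2)] by (intro add_pos_pos mult_pos_pos) auto
    show ?thesis
    proof (cases "\<xi> i = \<xi> j")
      case True
      then have "exchange i j \<xi> = \<xi>" by (auto simp: exchange_def fun_eq_iff Transposition.transpose_def)
      then show ?thesis by simp
    next
      case False
      then have "exchange_rate p i j \<xi> + exchange_rate p i j (exchange i j \<xi>) = 1"
        using den by (cases "\<xi> i"; cases "\<xi> j")
          (auto simp: exchange_def exchange_rate_def add_divide_distrib[symmetric] add.commute)
      then have R: "exchange_rate p i j (exchange i j \<xi>) = 1 - exchange_rate p i j \<xi>" by linarith
      show ?thesis unfolding g_def exchange_exchange R by (simp add: algebra_simps)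
    qed
  qed
  have h_eq: "h \<xi> = g \<xi>" if "\<xi> \<in> ?C" for \<xi>
  proof -
    have "(\<Sum>\<zeta>\<in>?C. g \<zeta> * of_bool (agree \<xi> \<zeta>)) = (\<Sum>\<zeta>\<in>?C. g \<xi> * of_bool (agree \<xi> \<zeta>))"
      using agree_cases[OF that] g_exchange by (intro sum.cong) auto
    also have "\<dots> = g \<xi> * (\<Sum>\<zeta>\<in>?C. of_bool (agree \<xi> \<zeta>))"
      by (simp add: sum_distrib_left)
    finally have "(\<Sum>\<zeta>\<in>?C. g \<zeta> * of_bool (agree \<xi> \<zeta>)) = g \<xi> * (\<Sum>\<zeta>\<in>?C. of_bool (agree \<xi> \<zeta>))" .
    moreover have "(\<Sum>\<zeta>\<in>?C. of_bool (agree \<xi> \<zeta>) :: real) > 0"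
      using that by (intro sum_pos2[of _ \<xi>]) (auto simp: finite_config_space agree_def)
    ultimately show ?thesis by (simp add: h_def)
  qed
  have exch_inv: "exchange i j \<xi> \<in> A \<longleftrightarrow> \<xi> \<in> A" if "A \<in> sets ?F" for A \<xi>
  proof -
    have "A \<in> sigma_sets UNIV {{\<eta>. \<eta> l = v} | l v. l \<in> {1..N} - {i, j}}"
      using that by (simp add: sites_algebra_def)
    then show ?thesis
      by (induction arbitrary: \<xi> rule: sigma_sets.induct) (auto simp: exchange_def)
  qed
  have sub: "subalgebra ?M ?F"
    by (simp add: subalgebra_def space_F)
  interpret sigma_finite_subalgebra ?M ?F
    by (intro finite_measure_subalgebra_is_sigma_finite)
       (unfold_locales, use sub in \<open>auto simp: subalgebra_def\<close>)
  have fin: "finite (set_pmf (cond_product N p w))"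
    by (simp add: set_cond_product finite_config_space)
  have int_eq: "measure_pmf.expectation (cond_product N p w) k =
      (\<Sum>\<xi>\<in>?C. pmf (cond_product N p w) \<xi> * k \<xi>)" for k :: "_ \<Rightarrow> real"
    by (subst integral_measure_pmf[OF finite_config_space[of N w]])
       (auto simp: set_cond_product)
  have bal: "(\<Sum>\<xi>\<in>?C. pmf (cond_product N p w) \<xi> * (indicator A \<xi> * (exchange_rate p i j \<xi> * f (exchange i j \<xi>))))
      = (\<Sum>\<xi>\<in>?C. pmf (cond_product N p w) \<xi> * (indicator A \<xi> * (exchange_rate p i j \<xi> * f \<xi>)))"
    if "A \<in> sets ?F" for A
  proof (rule sum.reindex_bij_witness[of _ "exchange i j" "exchange i j"])
    fix \<xi> assume x: "\<xi> \<in> ?C"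
    have "indicator A (exchange i j \<xi>) = (indicator A \<xi> :: real)"
      using exch_inv[OF that] by (simp add: indicator_def)
    then show "pmf (cond_product N p w) (exchange i j \<xi>) *
          (indicator A (exchange i j \<xi>) * (exchange_rate p i j (exchange i j \<xi>) * f (exchange i j \<xi>))) =
        pmf (cond_product N p w) \<xi> * (indicator A \<xi> * (exchange_rate p i j \<xi> * f (exchange i j \<xi>)))"
      using detailed_balance[OF ij x] by (simp add: mult.left_commute mult.assoc[symmetric])
  qed (use ij in \<open>auto intro!: exchange_in_config_space\<close>)
  have "AE \<xi> in ?M. real_cond_exp ?M ?F f \<xi> = h \<xi>"
  proof (rule real_cond_exp_charact)
    fix A assume A: "A \<in> sets ?F"
    have "set_lebesgue_integral ?M A h = (\<Sum>\<xi>\<in>?C. pmf (cond_product N p w) \<xi> * (indicator A \<xi> * h \<xi>))"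
      by (simp add: set_lebesgue_integral_def int_eq)
    also have "\<dots> = (\<Sum>\<xi>\<in>?C. pmf (cond_product N p w) \<xi> * (indicator A \<xi> * g \<xi>))"
      by (simp add: h_eq)
    also have "\<dots> = (\<Sum>\<xi>\<in>?C. pmf (cond_product N p w) \<xi> * (indicator A \<xi> * f \<xi>))"
      using bal[OF A] by (simp add: g_def algebra_simps sum.distrib sum_subtractf)
    also have "\<dots> = set_lebesgue_integral ?M A f"
      by (simp add: set_lebesgue_integral_def int_eq)
    finally show "set_lebesgue_integral ?M A f = set_lebesgue_integral ?M A h" ..
  qed (use h_meas fin in \<open>auto intro: integrable_measure_pmf_finite\<close>)
  then have "real_cond_exp ?M ?F f \<eta> = h \<eta>"
    using \<eta> by (simp add: AE_measure_pmf_iff set_cond_product)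
  then show ?thesis
    using h_eq[OF \<eta>] by (simp add: g_def)
qed

lemma generator_eq_real_cond_exp:
  assumes "\<eta> \<in> config_space N w"
  shows "generator N p f \<eta> =
    1 / real N * (\<Sum>(i, j) \<in> {(i, j). 1 \<le> i \<and> i < j \<and> j \<le> N}.
      real_cond_exp (cond_product N p w) (sites_algebra N {i, j}) f \<eta> - f \<eta>)"
  unfolding generator_def
  using assms by (auto intro!: sum.cong simp: real_cond_exp_pair)

end

end

theory Submission
  imports Defs
begin

text \<open>
  With \<open>x\<^sub>i = p\<^sub>i / (1 - p\<^sub>i)\<close>, the law \<open>\<nu>\<close> gives the set \<open>S\<close> of occupied sites a probability
  proportional to \<open>\<Prod>\<^sub>i\<^sub>\<in>\<^sub>S x\<^sub>i\<close>, normalised by the elementary symmetric polynomial \<open>e\<^sub>k(x)\<close>. The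
  ratios \<open>e\<^sub>k\<^sub>+\<^sub>1 / e\<^sub>k\<close> are superadditive on positive vectors (Marcus and Lopes), so \<open>e\<^sub>k\<close> is
  log-concave; to second order at \<open>x\<close> this bounds the variance of a centred sum
  \<open>\<Sum>\<^sub>i\<^sub>\<in>\<^sub>S h\<^sub>i\<close> by the expectation of \<open>\<Sum>\<^sub>i\<^sub>\<in>\<^sub>S h\<^sub>i\<^sup>2\<close>, with the sharp constant 1. Conditioning on
  one occupied site and inducting on \<open>k\<close> then shows that the down-up walk (remove a uniformly chosen
  particle, put it back at a site chosen with probability proportional to \<open>x\<close>) has spectral gap at
  least \<open>1 / k\<close>. If at most about half of the sites are occupied, a given jump of that walk has
  probability of order \<open>1 / (k N)\<close>, while the exclusion process performs it at a rate of order
  \<open>1 / N\<close>; hence the gap of the latter is bounded below. The case of high density follows by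
  exchanging particles and holes, which replaces \<open>x\<close> by \<open>1 / x\<close>.
\<close>

section \<open>Elementary symmetric polynomials as sums over subsets of fixed size\<close>

definition k_subsets :: "'a set \<Rightarrow> nat \<Rightarrow> 'a set set" where
  "k_subsets V k = {S. S \<subseteq> V \<and> card S = k}"

definition esym :: "'a set \<Rightarrow> nat \<Rightarrow> ('a \<Rightarrow> real) \<Rightarrow> real" where
  "esym V k x = (\<Sum>S\<in>k_subsets V k. prod x S)"

lemma finite_k_subsets [simp]: "finite V \<Longrightarrow> finite (k_subsets V k)"
  by (rule finite_subset[of _ "Pow V"]) (auto simp: k_subsets_def)

lemma k_subsets_0 [simp]: "finite V \<Longrightarrow> k_subsets V 0 = {{}}"
  by (auto simp: k_subsets_def dest: finite_subset)

lemma k_subsets_finite: "finite V \<Longrightarrow> S \<in> k_subsets V k \<Longrightarrow> finite S"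
  by (auto simp: k_subsets_def intro: finite_subset)

lemma k_subsets_nonempty:
  assumes "finite V" "k \<le> card V"
  shows "k_subsets V k \<noteq> {}"
  using obtain_subset_with_card_n[OF assms(2)] by (auto simp: k_subsets_def)

lemma esym_0 [simp]: "finite V \<Longrightarrow> esym V 0 x = 1"
  by (simp add: esym_def)

lemma esym_pos:
  assumes "finite V" "k \<le> card V" "\<And>i. i \<in> V \<Longrightarrow> x i > 0"
  shows "esym V k x > 0"
  unfolding esym_def using assms
  by (intro sum_pos k_subsets_nonempty prod_pos finite_k_subsets) (auto simp: k_subsets_def)

lemma sum_k_subsets_member:
  assumes V: "finite V" and l: "l \<in> V"
  shows "(\<Sum>S\<in>{S\<in>k_subsets V (Suc k). l \<in> S}. F S) = (\<Sum>S\<in>k_subsets (V - {l}) k. F (insert l S))"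
proof (rule sum.reindex_bij_witness[of _ "insert l" "\<lambda>S. S - {l}"])
  fix S assume "S \<in> k_subsets (V - {l}) k"
  moreover from this have "finite S" using V by (auto intro: k_subsets_finite)
  ultimately show "insert l S \<in> {S \<in> k_subsets V (Suc k). l \<in> S}"
    using V l by (auto simp: k_subsets_def card_insert_if)
qed (use V l in \<open>auto simp: k_subsets_def insert_absorb\<close>)

text \<open>Double counting of pairs (l, S) with l in S. It carries identities at level
  \<open>k\<close> on \<open>V - {l}\<close>, that is, given a particle at l, to level
  \<open>k + 1\<close> on \<open>V\<close>.\<close>

lemma sum_k_subsets_Suc:
  assumes V: "finite V"
  shows "(\<Sum>l\<in>V. \<Sum>S\<in>k_subsets (V - {l}) k. F l (insert l S)) = (\<Sum>S\<in>k_subsets V (Suc k). \<Sum>l\<in>S. F l S)"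
proof -
  have "(\<Sum>l\<in>V. \<Sum>S\<in>k_subsets (V - {l}) k. F l (insert l S)) =
      (\<Sum>l\<in>V. \<Sum>S\<in>{S\<in>k_subsets V (Suc k). l \<in> S}. F l S)"
    by (rule sum.cong[OF refl]) (rule sum_k_subsets_member[OF V, symmetric])
  also have "\<dots> = (\<Sum>S\<in>k_subsets V (Suc k). \<Sum>l\<in>{l\<in>V. l \<in> S}. F l S)"
    using V by (intro sum.swap_restrict) auto
  also have "\<dots> = (\<Sum>S\<in>k_subsets V (Suc k). \<Sum>l\<in>S. F l S)"
    by (intro sum.cong) (auto simp: k_subsets_def)
  finally show ?thesis .
qed

lemma prod_insert_k_subset:
  assumes "finite V" "S \<in> k_subsets (V - {l}) k"
  shows "prod x (insert l S) = x l * prod x S"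
  using assms by (subst prod.insert) (auto simp: k_subsets_def dest: finite_subset)

text \<open>Euler's identity for a homogeneous polynomial of degree \<open>k + 1\<close>: the
  derivative of \<open>esym V (Suc k) x\<close> in \<open>x l\<close> is
  \<open>esym (V - {l}) k x\<close>.\<close>

lemma esym_Suc:
  assumes V: "finite V"
  shows "real (Suc k) * esym V (Suc k) x = (\<Sum>l\<in>V. x l * esym (V - {l}) k x)"
proof -
  have "(\<Sum>l\<in>V. x l * esym (V - {l}) k x) = (\<Sum>l\<in>V. \<Sum>S\<in>k_subsets (V - {l}) k. prod x (insert l S))"
    unfolding esym_def sum_distrib_left using V
    by (intro sum.cong refl) (simp add: prod_insert_k_subset)
  also have "\<dots> = (\<Sum>S\<in>k_subsets V (Suc k). \<Sum>l\<in>S. prod x S)"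
    by (rule sum_k_subsets_Suc[OF V])
  also have "\<dots> = (\<Sum>S\<in>k_subsets V (Suc k). real (Suc k) * prod x S)"
    by (intro sum.cong) (auto simp: k_subsets_def)
  finally show ?thesis by (simp add: esym_def sum_distrib_left)
qed

lemma esym_split:
  assumes V: "finite V" and l: "l \<in> V"
  shows "esym V (Suc k) x = esym (V - {l}) (Suc k) x + x l * esym (V - {l}) k x"
proof -
  have "k_subsets V (Suc k) = k_subsets (V - {l}) (Suc k) \<union> {S\<in>k_subsets V (Suc k). l \<in> S}"
    by (auto simp: k_subsets_def)
  then have "esym V (Suc k) x = (\<Sum>S\<in>k_subsets (V - {l}) (Suc k) \<union> {S\<in>k_subsets V (Suc k). l \<in> S}. prod x S)"
    by (simp add: esym_def)
  also have "\<dots> = esym (V - {l}) (Suc k) x + (\<Sum>S\<in>{S\<in>k_subsets V (Suc k). l \<in> S}. prod x S)"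
    unfolding esym_def using V by (intro sum.union_disjoint) (auto simp: k_subsets_def)
  also have "(\<Sum>S\<in>{S\<in>k_subsets V (Suc k). l \<in> S}. prod x S) = x l * esym (V - {l}) k x"
    unfolding sum_k_subsets_member[OF V l] esym_def sum_distrib_left using V
    by (intro sum.cong refl) (simp add: prod_insert_k_subset)
  finally show ?thesis .
qed

section \<open>Superadditivity of ratios and log-concavity\<close>

text \<open>The function a b / (a + b) is concave and homogeneous of degree one on positive
  arguments; the defect is a square over a positive denominator.\<close>

lemma parallel_sum_superadditive:
  fixes a b c d :: real
  assumes "a > 0" "b > 0" "c > 0" "d > 0"
  shows "a * b / (a + b) + c * d / (c + d) \<le> (a + c) * (b + d) / ((a + c) + (b + d))"
proof -
  have "(a + c) * (b + d) / ((a + c) + (b + d)) - (a * b / (a + b) + c * d / (c + d)) =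
      (a * d - b * c)\<^sup>2 / ((a + b) * (c + d) * ((a + c) + (b + d)))"
    using assms by (simp add: divide_simps add_pos_pos less_imp_neq[symmetric] power2_eq_square) algebra
  also have "\<dots> \<ge> 0" using assms by simp
  finally show ?thesis by simp
qed

lemma parallel_sum_mono:
  fixes a b c :: real
  assumes "a > 0" "b > 0" "b \<le> c"
  shows "a * b / (a + b) \<le> a * c / (a + c)"
proof -
  have "a * c / (a + c) - a * b / (a + b) = a\<^sup>2 * (c - b) / ((a + b) * (a + c))"
    using assms by (simp add: divide_simps power2_eq_square) algebra
  also have "\<dots> \<ge> 0" using assms by simp
  finally show ?thesis by simp
qed

text \<open>Superadditivity of the ratios passes from \<open>k\<close> to \<open>k + 1\<close> because of this expression as a sum of
  parallel sums.\<close>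

lemma esym_ratio_Suc:
  assumes V: "finite V" and k: "Suc k < card V" and x: "\<And>i. i \<in> V \<Longrightarrow> x i > 0"
  shows "esym V (Suc (Suc k)) x / esym V (Suc k) x = 1 / real (Suc (Suc k)) *
    (\<Sum>l\<in>V. x l * (esym (V - {l}) (Suc k) x / esym (V - {l}) k x) /
       (x l + esym (V - {l}) (Suc k) x / esym (V - {l}) k x))"
proof -
  have "x l * esym (V - {l}) (Suc k) x / esym V (Suc k) x =
      x l * (esym (V - {l}) (Suc k) x / esym (V - {l}) k x) /
       (x l + esym (V - {l}) (Suc k) x / esym (V - {l}) k x)" if l: "l \<in> V" for l
  proof -
    have "esym (V - {l}) k x > 0" "esym (V - {l}) (Suc k) x > 0"
      using V k l x by (auto intro!: esym_pos)
    then show ?thesis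
      using x[OF l] unfolding esym_split[OF V l]
      by (simp add: divide_simps add_pos_pos less_imp_neq[symmetric] algebra_simps)
  qed
  then have "(\<Sum>l\<in>V. x l * esym (V - {l}) (Suc k) x) / esym V (Suc k) x =
     (\<Sum>l\<in>V. x l * (esym (V - {l}) (Suc k) x / esym (V - {l}) k x) /
       (x l + esym (V - {l}) (Suc k) x / esym (V - {l}) k x))"
    unfolding sum_divide_distrib by (rule sum.cong[OF refl])
  then show ?thesis
    unfolding esym_Suc[OF V, symmetric] by (simp add: field_simps)
qed

text \<open>Induction on \<open>k\<close> with \<open>V\<close> varying. For \<open>k = 0\<close>
  the ratio is linear. In the step it is a sum of parallel sums of \<open>x l\<close> with the ratio
  on \<open>V - {l}\<close>; these are jointly superadditive, and monotone in the second argument,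
  where the induction hypothesis enters.\<close>

lemma esym_ratio_superadditive:
  assumes "finite V" "k < card V" "\<And>i. i \<in> V \<Longrightarrow> x i > 0" "\<And>i. i \<in> V \<Longrightarrow> y i > 0"
  shows "esym V (Suc k) x / esym V k x + esym V (Suc k) y / esym V k y
    \<le> esym V (Suc k) (\<lambda>i. x i + y i) / esym V k (\<lambda>i. x i + y i)"
  using assms
proof (induction k arbitrary: V)
  case 0
  then have "esym V (Suc 0) z = (\<Sum>l\<in>V. z l)" for z
    using esym_Suc[of V 0 z] by simp
  with 0 show ?case by (simp add: sum.distrib)
next
  case (Suc k)
  let ?z = "\<lambda>i. x i + y i"
  let ?q = "\<lambda>l u. esym (V - {l}) (Suc k) u / esym (V - {l}) k u"
  have *: "x l * ?q l x / (x l + ?q l x) + y l * ?q l y / (y l + ?q l y) \<le> ?z l * ?q l ?z / (?z l + ?q l ?z)"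
    if l: "l \<in> V" for l
  proof -
    have pos: "?q l u > 0" if "\<And>i. i \<in> V \<Longrightarrow> u i > 0" for u
      using Suc.prems l that by (intro divide_pos_pos esym_pos) auto
    have qx: "?q l x > 0" and qy: "?q l y > 0"
      using Suc.prems by (auto intro!: pos)
    have "x l * ?q l x / (x l + ?q l x) + y l * ?q l y / (y l + ?q l y)
        \<le> ?z l * (?q l x + ?q l y) / (?z l + (?q l x + ?q l y))"
      using Suc.prems l by (intro parallel_sum_superadditive qx qy) auto
    also have "\<dots> \<le> ?z l * ?q l ?z / (?z l + ?q l ?z)"
    proof (rule parallel_sum_mono)
      show "?q l x + ?q l y \<le> ?q l ?z"
        using Suc.prems l by (intro Suc.IH) auto
    qed (use Suc.prems l qx qy in \<open>auto intro: add_pos_pos\<close>)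
    finally show ?thesis .
  qed
  have ratio: "esym V (Suc (Suc k)) u / esym V (Suc k) u =
      1 / real (Suc (Suc k)) * (\<Sum>l\<in>V. u l * ?q l u / (u l + ?q l u))"
    if "\<forall>i\<in>V. u i > 0" for u
    using Suc.prems(1,2) that by (intro esym_ratio_Suc) auto
  have pos: "\<forall>i\<in>V. x i > 0" "\<forall>i\<in>V. y i > 0" "\<forall>i\<in>V. ?z i > 0"
    using Suc.prems by (auto intro: add_pos_pos)
  have "1 / real (Suc (Suc k)) * ((\<Sum>l\<in>V. x l * ?q l x / (x l + ?q l x)) + (\<Sum>l\<in>V. y l * ?q l y / (y l + ?q l y)))
      \<le> 1 / real (Suc (Suc k)) * (\<Sum>l\<in>V. ?z l * ?q l ?z / (?z l + ?q l ?z))"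
    unfolding sum.distrib[symmetric] by (intro mult_left_mono sum_mono *) auto
  then show ?case
    unfolding pos[THEN ratio] distrib_left .
qed

text \<open>By homogeneity this is midpoint log-concavity. Writing \<open>esym\<close> as a
  telescoping product of ratios q, each factor satisfies 4 q(x) q(y) \<le> (q(x) + q(y))^2 \<le> q(x
  + y)^2.\<close>

lemma esym_log_concave:
  assumes V: "finite V" and "k \<le> card V"
    and x: "\<And>i. i \<in> V \<Longrightarrow> x i > 0" and y: "\<And>i. i \<in> V \<Longrightarrow> y i > 0"
  shows "4 ^ k * (esym V k x * esym V k y) \<le> (esym V k (\<lambda>i. x i + y i))\<^sup>2"
  using assms(2)
proof (induction k)
  case 0
  then show ?case using V by simp
next
  case (Suc k)
  let ?z = "\<lambda>i. x i + y i"
  let ?q = "\<lambda>u. esym V (Suc k) u / esym V k u"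
  have z: "?z i > 0" if "i \<in> V" for i using x y that by (auto intro: add_pos_pos)
  have e: "esym V k x > 0" "esym V k y > 0" "esym V k ?z > 0"
    using V Suc.prems x y z by (auto intro!: esym_pos)
  have "?q x > 0" "?q y > 0"
    using V Suc.prems x y by (auto intro!: esym_pos divide_pos_pos)
  moreover have "?q x + ?q y \<le> ?q ?z"
    using Suc.prems V x y by (intro esym_ratio_superadditive) auto
  ultimately have "(?q x + ?q y)\<^sup>2 \<le> (?q ?z)\<^sup>2"
    by (intro power_mono) auto
  moreover have "4 * (?q x * ?q y) \<le> (?q x + ?q y)\<^sup>2"
    using zero_le_power2[of "?q x - ?q y"] by (simp add: power2_eq_square algebra_simps)
  ultimately have q: "4 * (?q x * ?q y) \<le> (?q ?z)\<^sup>2"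
    by linarith
  have "4 ^ Suc k * (esym V (Suc k) x * esym V (Suc k) y) =
      (4 ^ k * (esym V k x * esym V k y)) * (4 * (?q x * ?q y))"
    using e by simp
  also have "\<dots> \<le> (esym V k ?z)\<^sup>2 * (?q ?z)\<^sup>2"
    using Suc e by (intro mult_mono q mult_nonneg_nonneg[of 4] less_imp_le[OF mult_pos_pos]
      \<open>?q x > 0\<close> \<open>?q y > 0\<close>) auto
  also have "\<dots> = (esym V (Suc k) ?z)\<^sup>2"
    using e by (simp add: power_divide)
  finally show ?case .
qed

section \<open>Second moments of linear statistics\<close>

text \<open>The quadratic coefficient is the second elementary symmetric polynomial of
  \<open>h\<close> on \<open>S\<close>, written through power sums. Continuity of the remainder
  \<open>r\<close> makes the cubic term negligible as t tends to 0.\<close>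

lemma prod_one_plus_expansion:
  fixes h :: "'a \<Rightarrow> real"
  assumes "finite S"
  shows "\<exists>r. continuous_on UNIV r \<and> (\<forall>t. (\<Prod>i\<in>S. 1 + t * h i) =
    1 + t * sum h S + t\<^sup>2 * (((sum h S)\<^sup>2 - (\<Sum>i\<in>S. (h i)\<^sup>2)) / 2) + t ^ 3 * r t)"
  using assms
proof (induction S)
  case empty
  show ?case by (intro exI[of _ "\<lambda>_. 0"]) auto
next
  case (insert a S)
  then obtain r where r: "continuous_on UNIV r" "\<And>t. (\<Prod>i\<in>S. 1 + t * h i) =
    1 + t * sum h S + t\<^sup>2 * (((sum h S)\<^sup>2 - (\<Sum>i\<in>S. (h i)\<^sup>2)) / 2) + t ^ 3 * r t"
    by blast
  let ?r = "\<lambda>t. r t + h a * (((sum h S)\<^sup>2 - (\<Sum>i\<in>S. (h i)\<^sup>2)) / 2) + t * h a * r t"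
  have "continuous_on UNIV ?r"
    by (intro continuous_intros r)
  moreover have "\<forall>t. (\<Prod>i\<in>insert a S. 1 + t * h i) =
    1 + t * sum h (insert a S) + t\<^sup>2 * (((sum h (insert a S))\<^sup>2 - (\<Sum>i\<in>insert a S. (h i)\<^sup>2)) / 2) + t ^ 3 * ?r t"
    using insert.hyps by (simp add: r(2) power2_eq_square power3_eq_cube field_simps)
  ultimately show ?case by blast
qed

text \<open>Tilting the weights by 1 + t h and 1 - t h, log-concavity gives \<phi>(t) \<phi>(-t)
  \<le> \<phi>(0)^2. Mean zero removes the first-order term, so the coefficient 2 a b of t^2 is at
  most 0, and 2 b is the left side minus the right side.\<close>

lemma second_moment_le:
  fixes h x :: "'a \<Rightarrow> real"
  assumes V: "finite V" and k: "k \<le> card V" and x: "\<And>i. i \<in> V \<Longrightarrow> x i > 0"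
    and mean: "(\<Sum>S\<in>k_subsets V k. prod x S * sum h S) = 0"
  shows "(\<Sum>S\<in>k_subsets V k. prod x S * (sum h S)\<^sup>2) \<le> (\<Sum>S\<in>k_subsets V k. prod x S * (\<Sum>i\<in>S. (h i)\<^sup>2))"
proof -
  let ?q = "\<lambda>S. ((sum h S)\<^sup>2 - (\<Sum>i\<in>S. (h i)\<^sup>2)) / 2"
  have "\<forall>S\<in>k_subsets V k. \<exists>r. continuous_on UNIV r \<and> (\<forall>t. (\<Prod>i\<in>S. 1 + t * h i) =
    1 + t * sum h S + t\<^sup>2 * ?q S + t ^ 3 * r t)"
    using V by (intro ballI prod_one_plus_expansion) (rule k_subsets_finite)
  then obtain r where rc: "\<And>S. S \<in> k_subsets V k \<Longrightarrow> continuous_on UNIV (r S)"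
    and r: "\<And>S t. S \<in> k_subsets V k \<Longrightarrow> (\<Prod>i\<in>S. 1 + t * h i) = 1 + t * sum h S + t\<^sup>2 * ?q S + t ^ 3 * r S t"
    by metis
  define \<phi> where "\<phi> t = esym V k (\<lambda>i. x i * (1 + t * h i))" for t
  define R where "R t = (\<Sum>S\<in>k_subsets V k. prod x S * r S t)" for t
  define a where "a = esym V k x"
  define b where "b = (\<Sum>S\<in>k_subsets V k. prod x S * ?q S)"
  have a: "a > 0" unfolding a_def using V k x by (rule esym_pos)
  have \<phi>: "\<phi> t = a + t\<^sup>2 * b + t ^ 3 * R t" for t
  proof -
    have "\<phi> t = (\<Sum>S\<in>k_subsets V k. prod x S * (1 + t * sum h S + t\<^sup>2 * ?q S + t ^ 3 * r S t))"
      unfolding \<phi>_def esym_def prod.distrib by (intro sum.cong refl) (simp add: r)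
    also have "\<dots> = a + t * (\<Sum>S\<in>k_subsets V k. prod x S * sum h S) + t\<^sup>2 * b + t ^ 3 * R t"
      unfolding a_def b_def R_def esym_def sum_distrib_left[where A = "k_subsets V k"] sum.distrib[symmetric]
      by (intro sum.cong refl) algebra
    finally show ?thesis using mean by simp
  qed
  have "continuous_on UNIV R" unfolding R_def using rc by (intro continuous_intros) auto
  \<comment> \<open>\<open>\<phi> t * \<phi> (- t) = a\<^sup>2 + t\<^sup>2 * Q t\<close>, since the mean vanishes\<close>
  define Q where "Q t = 2 * a * b + t * (a * (R t - R (- t)) + t * b\<^sup>2 + t\<^sup>2 * b * (R t - R (- t)) - t ^ 3 * R t * R (- t))" for t
  have "continuous_on UNIV (\<lambda>t. R (- t))"
    by (rule continuous_on_compose2[OF \<open>continuous_on UNIV R\<close>]) (auto intro: continuous_intros)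
  then have "continuous_on UNIV Q"
    unfolding Q_def by (intro continuous_intros \<open>continuous_on UNIV R\<close>)
  then have "isCont Q 0"
    by (simp add: continuous_on_eq_continuous_at)
  then have lim: "(Q \<longlongrightarrow> 2 * a * b) (at_right 0)"
    by (auto simp: isCont_def Q_def intro: tendsto_mono[OF at_le])
  \<comment> \<open>For small t both tilted weight vectors are positive, as log-concavity
    requires.\<close>
  have near: "\<forall>\<^sub>F t in at_right 0. \<forall>i\<in>V. 1 + t * h i > 0 \<and> 1 + (- t) * h i > 0"
  proof (intro eventually_ball_finite V ballI eventually_conj)
    fix i
    have "((\<lambda>t. 1 + t * h i) \<longlongrightarrow> 1 + 0 * h i) (at_right 0)" "((\<lambda>t. 1 + (- t) * h i) \<longlongrightarrow> 1 + (- 0) * h i) (at_right 0)"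
      by (intro tendsto_intros)+
    then show "\<forall>\<^sub>F t in at_right 0. 1 + t * h i > 0" "\<forall>\<^sub>F t in at_right 0. 1 + (- t) * h i > 0"
      by (auto dest: order_tendstoD(1)[of _ 1 _ 0])
  qed
  have "\<forall>\<^sub>F t in at_right 0. Q t \<le> 0"
    using near eventually_at_right_less[of "0 :: real"]
  proof eventually_elim
    case (elim t)
    \<comment> \<open>The two tilted vectors add up to 2 x, and homogeneity of degree k then cancels
      the factor 4^k.\<close>
    have "4 ^ k * (\<phi> t * \<phi> (- t)) \<le> (esym V k (\<lambda>i. x i * (1 + t * h i) + x i * (1 + (- t) * h i)))\<^sup>2"
      unfolding \<phi>_def using elim x by (intro esym_log_concave V k) auto
    also have "(\<lambda>i. x i * (1 + t * h i) + x i * (1 + (- t) * h i)) = (\<lambda>i. 2 * x i)"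
      by (auto simp: algebra_simps)
    also have "esym V k (\<lambda>i. 2 * x i) = 2 ^ k * a"
      unfolding a_def esym_def sum_distrib_left
      by (intro sum.cong refl) (auto simp: prod.distrib k_subsets_def)
    also have "(2 ^ k * a)\<^sup>2 = 4 ^ k * a\<^sup>2"
      by (simp add: power_mult_distrib power_mult[symmetric] mult.commute[of k] power_mult)
    finally have "\<phi> t * \<phi> (- t) \<le> a\<^sup>2"
      by simp
    moreover have "\<phi> t * \<phi> (- t) - a\<^sup>2 = t\<^sup>2 * Q t"
      unfolding \<phi> Q_def by (simp add: power2_eq_square power3_eq_cube algebra_simps)
    ultimately have "t\<^sup>2 * Q t \<le> 0" by linarith
    with elim show ?case by (simp add: mult_le_0_iff)
  qed
  then have "2 * a * b \<le> 0"
    by (intro tendsto_upperbound[OF lim]) auto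
  with a have "b \<le> 0" by (simp add: mult_le_0_iff)
  moreover have "2 * b = (\<Sum>S\<in>k_subsets V k. prod x S * (sum h S)\<^sup>2) - (\<Sum>S\<in>k_subsets V k. prod x S * (\<Sum>i\<in>S. (h i)\<^sup>2))"
    unfolding b_def sum_distrib_left[where A = "k_subsets V k"] sum_subtractf[symmetric] by (intro sum.cong refl) (simp add: field_simps)
  ultimately show ?thesis by linarith
qed


section \<open>The down-up walk and its spectral gap\<close>

text \<open>Dirichlet form of the down-up walk on sets of size \<open>k + 1\<close> (the set \<open>T\<close> has size \<open>k\<close>),
  multiplied by \<open>k + 1\<close> and by the normalising constant \<open>e\<^sub>k\<^sub>+\<^sub>1(x)\<close>.\<close>

definition down_up_form :: "'a set \<Rightarrow> ('a \<Rightarrow> real) \<Rightarrow> nat \<Rightarrow> ('a set \<Rightarrow> real) \<Rightarrow> real" where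
  "down_up_form V x k f = (\<Sum>T\<in>k_subsets V k. prod x T / (2 * sum x (V - T)) *
     (\<Sum>i\<in>V - T. \<Sum>j\<in>V - T. x i * x j * (f (insert i T) - f (insert j T))\<^sup>2))"

text \<open>The complement of T in \<open>V - {l}\<close> is that of \<open>insert l T\<close> in
  \<open>V\<close>, so each summand depends on \<open>insert l T\<close> alone, and every set of
  size k + 1 arises from k + 1 choices of l.\<close>

lemma down_up_form_Suc:
  assumes V: "finite V"
  shows "(\<Sum>l\<in>V. x l * down_up_form (V - {l}) x k (\<lambda>S. f (insert l S))) =
    real (Suc k) * down_up_form V x (Suc k) f"
proof -
  let ?t = "\<lambda>T. prod x T / (2 * sum x (V - T)) *
     (\<Sum>i\<in>V - T. \<Sum>j\<in>V - T. x i * x j * (f (insert i T) - f (insert j T))\<^sup>2)"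
  have eq: "V - {l} - T = V - insert l T" for l T by auto
  have "(\<Sum>l\<in>V. x l * down_up_form (V - {l}) x k (\<lambda>S. f (insert l S))) =
      (\<Sum>l\<in>V. \<Sum>T\<in>k_subsets (V - {l}) k. ?t (insert l T))"
    unfolding down_up_form_def sum_distrib_left[where A = "k_subsets _ _"] eq using V
    by (intro sum.cong refl) (simp add: prod_insert_k_subset insert_commute)
  also have "\<dots> = (\<Sum>T\<in>k_subsets V (Suc k). \<Sum>l\<in>T. ?t T)"
    by (rule sum_k_subsets_Suc[OF V])
  also have "\<dots> = (\<Sum>T\<in>k_subsets V (Suc k). real (Suc k) * ?t T)"
    by (intro sum.cong) (auto simp: k_subsets_def)
  finally show ?thesis by (simp add: down_up_form_def sum_distrib_left[where A = "k_subsets _ _"])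
qed

text \<open>Lagrange's identity: for weights of total mass 1 the right side is twice the variance of
  \<open>f\<close>. It settles the one-particle case of the gap bound.\<close>

lemma sum_sq_diff_weighted:
  fixes u f :: "'a \<Rightarrow> real"
  shows "(\<Sum>i\<in>V. \<Sum>j\<in>V. u i * u j * (f i - f j)\<^sup>2) =
    2 * (sum u V * (\<Sum>i\<in>V. u i * (f i)\<^sup>2) - (\<Sum>i\<in>V. u i * f i)\<^sup>2)"
proof -
  let ?A = "\<Sum>j\<in>V. u j * (f j)\<^sup>2" and ?B = "\<Sum>j\<in>V. u j * f j"
  have "(\<Sum>j\<in>V. u i * u j * (f i - f j)\<^sup>2) = u i * (f i)\<^sup>2 * sum u V + ?A * u i - 2 * ?B * (u i * f i)" for i
  proof -
    have "(\<Sum>j\<in>V. u i * u j * (f i - f j)\<^sup>2) =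
        (\<Sum>j\<in>V. u i * (f i)\<^sup>2 * u j + u i * (u j * (f j)\<^sup>2) - 2 * (u i * f i) * (u j * f j))"
      by (intro sum.cong refl) (simp add: power2_eq_square algebra_simps)
    then show ?thesis
      by (simp only: sum.distrib sum_subtractf sum_distrib_left[symmetric]) (simp add: mult_ac)
  qed
  then have "(\<Sum>i\<in>V. \<Sum>j\<in>V. u i * u j * (f i - f j)\<^sup>2) =
      (\<Sum>i\<in>V. u i * (f i)\<^sup>2 * sum u V + ?A * u i - 2 * ?B * (u i * f i))"
    by simp
  also have "\<dots> = ?A * sum u V + ?A * sum u V - 2 * ?B * ?B"
    by (simp only: sum.distrib sum_subtractf sum_distrib_left[symmetric] sum_distrib_right[symmetric])
  finally show ?thesis by (simp add: power2_eq_square algebra_simps)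
qed

lemma sum_singletons: "(\<Sum>S\<in>k_subsets V (Suc 0). F S) = (\<Sum>i\<in>V. F {i})"
proof (rule sum.reindex_bij_witness[of _ "\<lambda>i. {i}" the_elem])
qed (auto simp: k_subsets_def card_1_singleton_iff)

lemma weighted_second_moment_shift:
  fixes \<mu> f :: "'a \<Rightarrow> real"
  assumes "finite A" "sum \<mu> A \<noteq> 0" "c = (\<Sum>S\<in>A. \<mu> S * f S) / sum \<mu> A"
  shows "(\<Sum>S\<in>A. \<mu> S * (f S - c)) = 0"
    and "(\<Sum>S\<in>A. \<mu> S * (f S - c)\<^sup>2) = (\<Sum>S\<in>A. \<mu> S * (f S)\<^sup>2) - (\<Sum>S\<in>A. \<mu> S * f S)\<^sup>2 / sum \<mu> A"
proof -
  have "(\<Sum>S\<in>A. \<mu> S * (f S - c)) = (\<Sum>S\<in>A. \<mu> S * f S) - c * sum \<mu> A"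
    by (simp add: algebra_simps sum_subtractf sum_distrib_left)
  then show "(\<Sum>S\<in>A. \<mu> S * (f S - c)) = 0" using assms by simp
  have "(\<Sum>S\<in>A. \<mu> S * (f S - c)\<^sup>2) = (\<Sum>S\<in>A. \<mu> S * (f S)\<^sup>2 + c\<^sup>2 * \<mu> S - 2 * c * (\<mu> S * f S))"
    by (intro sum.cong refl) (simp add: power2_eq_square algebra_simps)
  also have "\<dots> = (\<Sum>S\<in>A. \<mu> S * (f S)\<^sup>2) + c\<^sup>2 * sum \<mu> A - 2 * c * (\<Sum>S\<in>A. \<mu> S * f S)"
    by (simp add: sum.distrib sum_subtractf sum_distrib_left)
  also have "\<dots> = (\<Sum>S\<in>A. \<mu> S * (f S)\<^sup>2) - (\<Sum>S\<in>A. \<mu> S * f S)\<^sup>2 / sum \<mu> A"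
    using assms by (simp add: power2_eq_square)
  finally show "(\<Sum>S\<in>A. \<mu> S * (f S - c)\<^sup>2) = (\<Sum>S\<in>A. \<mu> S * (f S)\<^sup>2) - (\<Sum>S\<in>A. \<mu> S * f S)\<^sup>2 / sum \<mu> A" .
qed

lemma sum_k_subsets_Suc_member:
  fixes F :: "'a \<Rightarrow> 'a set \<Rightarrow> real"
  assumes V: "finite V"
  shows "(\<Sum>S\<in>k_subsets V (Suc k). \<Sum>l\<in>S. F l S) = (\<Sum>l\<in>V. \<Sum>S\<in>{S\<in>k_subsets V (Suc k). l \<in> S}. F l S)"
  unfolding sum_k_subsets_Suc[OF V, symmetric]
  by (rule sum.cong[OF refl]) (rule sum_k_subsets_member[OF V, symmetric])

text \<open>With \<open>h\<^sub>l = \<nu>(f | l \<in> S)\<close>, Cauchy--Schwarz applied to \<open>f\<close> and \<open>\<Sum>\<^sub>l\<^sub>\<in>\<^sub>S h\<^sub>l\<close> reduces this to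
  the second moment bound for \<open>h\<close>.\<close>

lemma one_site_variance_le:
  fixes x :: "'a \<Rightarrow> real" and f :: "'a set \<Rightarrow> real"
  assumes V: "finite V" and k: "Suc k \<le> card V" and x: "\<And>i. i \<in> V \<Longrightarrow> x i > 0"
    and mean: "(\<Sum>S\<in>k_subsets V (Suc k). prod x S * f S) = 0"
  shows "(\<Sum>l\<in>V. (\<Sum>S\<in>{S\<in>k_subsets V (Suc k). l \<in> S}. prod x S * f S)\<^sup>2 /
            (\<Sum>S\<in>{S\<in>k_subsets V (Suc k). l \<in> S}. prod x S))
    \<le> (\<Sum>S\<in>k_subsets V (Suc k). prod x S * (f S)\<^sup>2)"
proof -
  let ?K = "k_subsets V (Suc k)"
  let ?L = "\<lambda>l. {S\<in>?K. l \<in> S}"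
  define F where "F l = (\<Sum>S\<in>?L l. prod x S * f S)" for l
  define P where "P l = (\<Sum>S\<in>?L l. prod x S)" for l
  define h where "h l = F l / P l" for l
  define M where "M = (\<Sum>S\<in>?K. prod x S * (f S)\<^sup>2)"
  define Q where "Q = (\<Sum>l\<in>V. (F l)\<^sup>2 / P l)"
  have wt: "prod x S > 0" if "S \<in> ?K" for S
    using that x by (intro prod_pos) (auto simp: k_subsets_def)
  have P: "P l > 0" if l: "l \<in> V" for l
  proof -
    have "P l = x l * esym (V - {l}) k x"
      unfolding P_def sum_k_subsets_member[OF V l] esym_def sum_distrib_left using V
      by (intro sum.cong refl) (simp add: prod_insert_k_subset)
    also have "\<dots> > 0" using V k x l by (intro mult_pos_pos esym_pos) auto
    finally show ?thesis .
  qed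
  have swap: "(\<Sum>S\<in>?K. prod x S * G S * sum g S) = (\<Sum>l\<in>V. g l * (\<Sum>S\<in>?L l. prod x S * G S))" for g G
  proof -
    have "(\<Sum>S\<in>?K. prod x S * G S * sum g S) = (\<Sum>S\<in>?K. \<Sum>l\<in>S. g l * (prod x S * G S))"
      unfolding sum_distrib_left by (intro sum.cong refl) (simp add: mult_ac)
    also have "\<dots> = (\<Sum>l\<in>V. g l * (\<Sum>S\<in>?L l. prod x S * G S))"
      unfolding sum_k_subsets_Suc_member[OF V] sum_distrib_left ..
    finally show ?thesis .
  qed
  have hP: "h l * P l = F l" if "l \<in> V" for l
    using P[OF that] by (simp add: h_def)
  \<comment> \<open>\<open>h\<close> inherits mean zero from \<open>f\<close>: the weighted sum
    becomes the sum of all \<open>F l\<close>, in which every S is counted \<open>Suc k\<close>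
    times.\<close>
  have "(\<Sum>S\<in>?K. prod x S * sum h S) = (\<Sum>l\<in>V. h l * P l)"
    using swap[of "\<lambda>_. 1" h] by (simp add: P_def)
  also have "\<dots> = (\<Sum>l\<in>V. F l)"
    by (simp add: hP)
  also have "\<dots> = (\<Sum>S\<in>?K. prod x S * f S * (\<Sum>l\<in>S. 1))"
    unfolding swap F_def by simp
  also have "\<dots> = real (Suc k) * (\<Sum>S\<in>?K. prod x S * f S)"
    unfolding sum_distrib_left by (intro sum.cong refl) (auto simp: k_subsets_def)
  finally have "(\<Sum>S\<in>?K. prod x S * sum h S) = 0" using mean by simp
  then have "(\<Sum>S\<in>?K. prod x S * (sum h S)\<^sup>2) \<le> (\<Sum>S\<in>?K. prod x S * (\<Sum>i\<in>S. (h i)\<^sup>2))"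
    by (intro second_moment_le V k x)
  also have "\<dots> = (\<Sum>l\<in>V. (h l)\<^sup>2 * P l)"
    using swap[of "\<lambda>_. 1" "\<lambda>l. (h l)\<^sup>2"] by (simp add: P_def)
  also have "\<dots> = Q"
    unfolding Q_def by (intro sum.cong refl) (simp add: h_def power2_eq_square)
  finally have 1: "(\<Sum>S\<in>?K. prod x S * (sum h S)\<^sup>2) \<le> Q" .
  have 2: "(\<Sum>S\<in>?K. prod x S * f S * sum h S) = Q"
    unfolding swap Q_def by (intro sum.cong refl) (simp add: F_def[symmetric] h_def power2_eq_square)
  \<comment> \<open>Expanding the square: \<open>M\<close> plus a term at most \<open>Q\<close>
    minus \<open>2 * Q\<close> is nonnegative, whence \<open>Q \<le> M\<close>.\<close>
  have "0 \<le> (\<Sum>S\<in>?K. prod x S * (f S - sum h S)\<^sup>2)"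
    using wt by (intro sum_nonneg) (simp add: less_imp_le)
  also have "\<dots> = (\<Sum>S\<in>?K. prod x S * (f S)\<^sup>2 + prod x S * (sum h S)\<^sup>2 - 2 * (prod x S * f S * sum h S))"
    by (intro sum.cong refl) (simp add: power2_eq_square algebra_simps)
  also have "\<dots> = M + (\<Sum>S\<in>?K. prod x S * (sum h S)\<^sup>2) - 2 * Q"
    by (simp add: sum.distrib sum_subtractf M_def 2[symmetric] sum_distrib_left[where A = ?K])
  finally have "Q \<le> M" using 1 by linarith
  then show ?thesis unfolding Q_def M_def F_def P_def .
qed

text \<open>The left side is the variance of \<open>f\<close> times the normalising constant. Given
  a particle at l, the others live on \<open>V - {l}\<close>, and the induction hypothesis bounds
  the conditional variance; the squared conditional means are bounded by
  \<open>one_site_variance_le\<close>. Summing over l gives (k + 2) M \<le> (k + 1) D + M, with M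
  the centred second moment and D the form, which reproduces the constant 1.\<close>

lemma down_up_gap:
  assumes "finite V" "Suc k \<le> card V" "\<And>i. i \<in> V \<Longrightarrow> x i > 0"
  shows "(\<Sum>S\<in>k_subsets V (Suc k). prod x S * (f S)\<^sup>2) -
      (\<Sum>S\<in>k_subsets V (Suc k). prod x S * f S)\<^sup>2 / esym V (Suc k) x \<le> down_up_form V x k f"
  using assms
proof (induction k arbitrary: V f)
  case 0
  then have "sum x V > 0" by (intro sum_pos) auto
  with 0 show ?case
    using sum_sq_diff_weighted[where V = V and u = x and f = "\<lambda>i. f {i}"]
    by (simp add: esym_def sum_singletons down_up_form_def diff_divide_distrib)
next
  case (Suc k V f)
  note V = Suc.prems(1) and x = Suc.prems(3)
  let ?n = "Suc (Suc k)"
  let ?K = "k_subsets V ?n"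
  let ?L = "\<lambda>l. {S\<in>?K. l \<in> S}"
  define c where "c = (\<Sum>S\<in>?K. prod x S * f S) / esym V ?n x"
  define g where "g S = f S - c" for S
  define M where "M = (\<Sum>S\<in>?K. prod x S * (g S)\<^sup>2)"
  have Z: "esym V ?n x > 0" by (intro esym_pos Suc.prems)
  note shift = weighted_second_moment_shift[of ?K "prod x" c f, folded esym_def, OF _ _ c_def, folded g_def]
  have mean: "(\<Sum>S\<in>?K. prod x S * g S) = 0"
    using V Z by (intro shift) auto
  have M: "M = (\<Sum>S\<in>?K. prod x S * (f S)\<^sup>2) - (\<Sum>S\<in>?K. prod x S * f S)\<^sup>2 / esym V ?n x"
    unfolding M_def using V Z by (intro shift) auto
  have D: "down_up_form V x (Suc k) g = down_up_form V x (Suc k) f"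
    by (simp add: down_up_form_def g_def)
  \<comment> \<open>Conditional variance given a particle at l, times the weight of that event; the
    factor \<open>x l\<close> comes out of every product.\<close>
  have step: "(\<Sum>S\<in>?L l. prod x S * (g S)\<^sup>2) -
      (\<Sum>S\<in>?L l. prod x S * g S)\<^sup>2 / (\<Sum>S\<in>?L l. prod x S) \<le>
      x l * down_up_form (V - {l}) x k (\<lambda>S. g (insert l S))" if l: "l \<in> V" for l
  proof -
    let ?V = "V - {l}"
    have lift: "(\<Sum>S\<in>?L l. prod x S * G S) = x l * (\<Sum>S\<in>k_subsets ?V (Suc k). prod x S * G (insert l S))" for G
      unfolding sum_k_subsets_member[OF V l] sum_distrib_left using V
      by (intro sum.cong refl) (simp add: prod_insert_k_subset)
    have lift1: "(\<Sum>S\<in>?L l. prod x S) = x l * esym ?V (Suc k) x"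
      using lift[of "\<lambda>_. 1"] by (simp add: esym_def)
    have "x l * ((\<Sum>S\<in>k_subsets ?V (Suc k). prod x S * (g (insert l S))\<^sup>2) -
      (\<Sum>S\<in>k_subsets ?V (Suc k). prod x S * g (insert l S))\<^sup>2 / esym ?V (Suc k) x) \<le>
      x l * down_up_form ?V x k (\<lambda>S. g (insert l S))"
      using Suc.prems l by (intro mult_left_mono Suc.IH less_imp_le[OF x]) auto
    then show ?thesis
      unfolding lift lift1 using x[OF l] by (simp add: power2_eq_square algebra_simps)
  qed
  have "real ?n * M = (\<Sum>S\<in>?K. \<Sum>l\<in>S. prod x S * (g S)\<^sup>2)"
    unfolding M_def sum_distrib_left by (intro sum.cong refl) (auto simp: k_subsets_def)
  also have "\<dots> = (\<Sum>l\<in>V. \<Sum>S\<in>?L l. prod x S * (g S)\<^sup>2)"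
    by (rule sum_k_subsets_Suc_member[OF V])
  also have "\<dots> \<le> (\<Sum>l\<in>V. x l * down_up_form (V - {l}) x k (\<lambda>S. g (insert l S)) +
      (\<Sum>S\<in>?L l. prod x S * g S)\<^sup>2 / (\<Sum>S\<in>?L l. prod x S))"
    using step by (intro sum_mono) (simp add: algebra_simps)
  also have "\<dots> = real (Suc k) * down_up_form V x (Suc k) g +
      (\<Sum>l\<in>V. (\<Sum>S\<in>?L l. prod x S * g S)\<^sup>2 / (\<Sum>S\<in>?L l. prod x S))"
    by (simp only: sum.distrib down_up_form_Suc[OF V])
  also have "\<dots> \<le> real (Suc k) * down_up_form V x (Suc k) g + M"
    unfolding M_def using Suc.prems by (intro add_left_mono one_site_variance_le mean) auto
  finally have "real (Suc k) * M \<le> real (Suc k) * down_up_form V x (Suc k) g"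
    by (simp add: algebra_simps)
  then have "M \<le> down_up_form V x (Suc k) g"
    by (subst (asm) mult_le_cancel_left_pos) auto
  then show ?case unfolding M D .
qed


section \<open>Comparison of the exclusion process with the down-up walk\<close>

text \<open>Dirichlet form of the exclusion process up to the factor 1 / (2 N) and normalisation: in
  terms of x = p / (1 - p), a particle at i is exchanged with a hole at j at rate x j / (x i + x
  j).\<close>

definition exchange_form :: "'a set \<Rightarrow> ('a \<Rightarrow> real) \<Rightarrow> nat \<Rightarrow> ('a set \<Rightarrow> real) \<Rightarrow> real" where
  "exchange_form V x k f = (\<Sum>i\<in>V. \<Sum>j\<in>V. \<Sum>S\<in>{S\<in>k_subsets V k. i \<in> S \<and> j \<notin> S}.
     prod x S * (x j / (x i + x j)) * (f (insert j (S - {i})) - f S)\<^sup>2)"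

text \<open>Writing S as \<open>insert i T\<close> moves the weight \<open>x i\<close> of the
  jumping particle into the rate, which becomes symmetric. The summands now match those of
  \<open>down_up_form\<close> except for 1 / (x i + x j) in place of
  \<open>1 / (2 * sum x (V - T))\<close>.\<close>

lemma exchange_form_Suc:
  assumes V: "finite V"
  shows "exchange_form V x (Suc k) f = (\<Sum>T\<in>k_subsets V k. \<Sum>i\<in>V - T. \<Sum>j\<in>V - T.
     prod x T * (x i * x j / (x i + x j)) * (f (insert i T) - f (insert j T))\<^sup>2)"
proof -
  let ?t = "\<lambda>T i j. prod x T * (x i * x j / (x i + x j)) * (f (insert i T) - f (insert j T))\<^sup>2"
  have "(\<Sum>T\<in>k_subsets V k. \<Sum>i\<in>V - T. \<Sum>j\<in>V - T. ?t T i j) =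
      (\<Sum>T\<in>k_subsets V k. \<Sum>i\<in>V. \<Sum>j\<in>V. if i \<notin> T \<and> j \<notin> T then ?t T i j else 0)"
  proof (rule sum.cong[OF refl])
    fix T
    have inner: "(\<Sum>j\<in>V - T. ?t T i j) = (\<Sum>j\<in>V. if i \<notin> T \<and> j \<notin> T then ?t T i j else 0)"
      if "i \<notin> T" for i
      using V that by (intro sum.mono_neutral_cong_left) auto
    show "(\<Sum>i\<in>V - T. \<Sum>j\<in>V - T. ?t T i j) = (\<Sum>i\<in>V. \<Sum>j\<in>V. if i \<notin> T \<and> j \<notin> T then ?t T i j else 0)"
      using V inner by (intro sum.mono_neutral_cong_left) auto
  qed
  also have "\<dots> = (\<Sum>i\<in>V. \<Sum>T\<in>k_subsets V k. \<Sum>j\<in>V. if i \<notin> T \<and> j \<notin> T then ?t T i j else 0)"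
    by (rule sum.swap)
  also have "\<dots> = (\<Sum>i\<in>V. \<Sum>j\<in>V. \<Sum>T\<in>k_subsets V k. if i \<notin> T \<and> j \<notin> T then ?t T i j else 0)"
    by (intro sum.cong refl sum.swap)
  also have "\<dots> = exchange_form V x (Suc k) f"
    unfolding exchange_form_def
  proof (rule sum.cong[OF refl], rule sum.cong[OF refl])
    fix i j assume i: "i \<in> V" and j: "j \<in> V"
    show "(\<Sum>T\<in>k_subsets V k. if i \<notin> T \<and> j \<notin> T then ?t T i j else 0) =
      (\<Sum>S\<in>{S\<in>k_subsets V (Suc k). i \<in> S \<and> j \<notin> S}.
        prod x S * (x j / (x i + x j)) * (f (insert j (S - {i})) - f S)\<^sup>2)"
    proof (cases "i = j")
      case True
      then have "{S\<in>k_subsets V (Suc k). i \<in> S \<and> j \<notin> S} = {}" by auto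
      then show ?thesis using True by (auto intro!: sum.neutral)
    next
      case False
      have "(\<Sum>T\<in>k_subsets V k. if i \<notin> T \<and> j \<notin> T then ?t T i j else 0) =
          (\<Sum>T\<in>{T\<in>k_subsets V k. i \<notin> T \<and> j \<notin> T}. ?t T i j)"
        using V by (simp only: sum.inter_filter finite_k_subsets)
      also have "\<dots> = (\<Sum>S\<in>{S\<in>k_subsets V (Suc k). i \<in> S \<and> j \<notin> S}.
        prod x S * (x j / (x i + x j)) * (f (insert j (S - {i})) - f S)\<^sup>2)"
      proof (rule sum.reindex_bij_witness[of _ "\<lambda>S. S - {i}" "insert i"])
        fix T assume T: "T \<in> {T\<in>k_subsets V k. i \<notin> T \<and> j \<notin> T}"
        then have fin: "finite T" using V by (auto intro: k_subsets_finite)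
        then show "insert i T \<in> {S\<in>k_subsets V (Suc k). i \<in> S \<and> j \<notin> S}"
          using T i False by (auto simp: k_subsets_def)
        have "insert i T - {i} = T" using T by auto
        then show "prod x (insert i T) * (x j / (x i + x j)) *
            (f (insert j (insert i T - {i})) - f (insert i T))\<^sup>2 = ?t T i j"
          using T fin by (simp add: power2_commute)
      qed (use V in \<open>auto simp: k_subsets_def insert_absorb\<close>)
      finally show ?thesis .
    qed
  qed
  finally show ?thesis ..
qed

text \<open>Particle-hole symmetry: a particle jumping from i to j is a hole jumping from j to i,
  and for y = 1 / x the rate y i / (y j + y i) equals x j / (x i + x j). The factor
  \<open>prod x V\<close> converts the weight of a set into that of its complement.\<close>

lemma exchange_form_complement:
  assumes V: "finite V" and k: "k \<le> card V" and x: "\<And>i. i \<in> V \<Longrightarrow> x i > 0"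
  shows "exchange_form V x k f = prod x V * exchange_form V (\<lambda>i. 1 / x i) (card V - k) (\<lambda>R. f (V - R))"
proof -
  let ?y = "\<lambda>i. 1 / x i"
  let ?c = "card V - k"
  have compl: "(\<Sum>S\<in>{S\<in>k_subsets V k. i \<in> S \<and> j \<notin> S}.
     prod x S * (x j / (x i + x j)) * (f (insert j (S - {i})) - f S)\<^sup>2) =
    (\<Sum>R\<in>{R\<in>k_subsets V ?c. j \<in> R \<and> i \<notin> R}.
     prod x V * (prod ?y R * (?y i / (?y j + ?y i)) * (f (V - insert i (R - {j})) - f (V - R))\<^sup>2))"
    if i: "i \<in> V" and j: "j \<in> V" for i j
  proof (rule sum.reindex_bij_witness[of _ "\<lambda>R. V - R" "\<lambda>S. V - S"])
    fix S assume S: "S \<in> {S\<in>k_subsets V k. i \<in> S \<and> j \<notin> S}"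
    then have SV: "S \<subseteq> V" by (auto simp: k_subsets_def)
    then show "V - S \<in> {R\<in>k_subsets V ?c. j \<in> R \<and> i \<notin> R}"
      using S V j by (auto simp: k_subsets_def card_Diff_subset finite_subset)
    have e: "V - insert i (V - S - {j}) = insert j (S - {i})" "V - (V - S) = S"
      using SV S i j by auto
    have "prod x V = prod x (V - S) * prod x S"
      using prod.subset_diff[OF SV V] .
    moreover have "prod x (V - S) > 0" using x by (intro prod_pos) auto
    ultimately have w: "prod x V * prod ?y (V - S) = prod x S"
      by (simp add: prod_dividef)
    have r: "?y i / (?y j + ?y i) = x j / (x i + x j)"
      using x[OF i] x[OF j] by (simp add: divide_simps add_pos_pos less_imp_neq[symmetric] add.commute)
    show "prod x V * (prod ?y (V - S) * (?y i / (?y j + ?y i)) * (f (V - insert i (V - S - {j})) - f (V - (V - S)))\<^sup>2) =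
      prod x S * (x j / (x i + x j)) * (f (insert j (S - {i})) - f S)\<^sup>2"
      unfolding e r w[symmetric] by simp
  next
    fix R assume R: "R \<in> {R\<in>k_subsets V ?c. j \<in> R \<and> i \<notin> R}"
    then show "V - R \<in> {S\<in>k_subsets V k. i \<in> S \<and> j \<notin> S}"
      using V k i by (auto simp: k_subsets_def card_Diff_subset finite_subset)
  qed (auto simp: k_subsets_def)
  have "exchange_form V x k f = (\<Sum>i\<in>V. \<Sum>j\<in>V. \<Sum>R\<in>{R\<in>k_subsets V ?c. j \<in> R \<and> i \<notin> R}.
     prod x V * (prod ?y R * (?y i / (?y j + ?y i)) * (f (V - insert i (R - {j})) - f (V - R))\<^sup>2))"
    unfolding exchange_form_def
    by (rule sum.cong[OF refl], rule sum.cong[OF refl], rule compl)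
  also have "\<dots> = (\<Sum>j\<in>V. \<Sum>i\<in>V. \<Sum>R\<in>{R\<in>k_subsets V ?c. j \<in> R \<and> i \<notin> R}.
     prod x V * (prod ?y R * (?y i / (?y j + ?y i)) * (f (V - insert i (R - {j})) - f (V - R))\<^sup>2))"
    by (rule sum.swap)
  finally show ?thesis
    unfolding exchange_form_def sum_distrib_left .
qed

text \<open>Term-by-term comparison with the down-up form. A set T of k - 1 particles leaves at
  least half of the sites free, so \<open>sum x (V - T)\<close> is of order
  \<open>card V\<close>.\<close>

lemma exchange_form_ge_low_density:
  assumes V: "finite V" and k: "0 < k" "2 * k \<le> card V + 2" "k \<le> card V"
    and C: "\<And>i. i \<in> V \<Longrightarrow> x i \<le> C" "\<And>i. i \<in> V \<Longrightarrow> 1 / C \<le> x i" "C > 0"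
    and mean: "(\<Sum>S\<in>k_subsets V k. prod x S * f S) = 0"
  shows "real (card V) * (\<Sum>S\<in>k_subsets V k. prod x S * (f S)\<^sup>2) \<le> 2 * C\<^sup>2 * exchange_form V x k f"
proof -
  obtain m where m: "k = Suc m" using k by (cases k) auto
  have x: "x i > 0" if "i \<in> V" for i
    using C(3) by (intro order.strict_trans2[OF _ C(2)[OF that]]) simp
  let ?N = "real (card V)"
  have *: "?N * (prod x T / (2 * sum x (V - T)) * (x i * x j * d\<^sup>2)) \<le>
      2 * C\<^sup>2 * (prod x T * (x i * x j / (x i + x j)) * d\<^sup>2)"
    if T: "T \<in> k_subsets V m" and i: "i \<in> V - T" and j: "j \<in> V - T" for T i j d
  proof -
    have TV: "T \<subseteq> V" "card T = m" using T by (auto simp: k_subsets_def)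
    \<comment> \<open>\<open>V - T\<close> has card V - k + 1 elements, which is at least half of
      card V exactly when 2 k \<le> card V + 2.\<close>
    have "?N / 2 * (1 / C) \<le> real (card (V - T)) * (1 / C)"
      using TV V k m C by (intro mult_right_mono) (auto simp: card_Diff_subset finite_subset)
    also have "\<dots> \<le> sum x (V - T)"
      using C by (intro sum_bounded_below) auto
    finally have s: "?N / (2 * C) \<le> sum x (V - T)" by simp
    have N: "?N > 0" using k by simp
    then have s0: "sum x (V - T) > 0" using s C by (intro less_le_trans[OF _ s]) simp
    have ij: "x i > 0" "x j > 0" "x i + x j \<le> 2 * C"
      using i j x C(1)[of i] C(1)[of j] by auto
    \<comment> \<open>\<open>C\<close> separates the two weights: one uses the lower bound on the
      sum, the other x i + x j \<le> 2 C.\<close>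
    have "?N / (2 * sum x (V - T)) \<le> C"
      using s s0 C by (simp add: field_simps)
    also have "C \<le> 2 * C\<^sup>2 / (x i + x j)"
      using ij C mult_left_mono[OF ij(3), of C] by (simp add: field_simps power2_eq_square)
    finally have r: "?N / (2 * sum x (V - T)) \<le> 2 * C\<^sup>2 / (x i + x j)" .
    have "prod x T \<ge> 0" using TV x by (intro prod_nonneg) (auto intro: less_imp_le)
    then have "(prod x T * (x i * x j) * d\<^sup>2) * (?N / (2 * sum x (V - T))) \<le>
        (prod x T * (x i * x j) * d\<^sup>2) * (2 * C\<^sup>2 / (x i + x j))"
      using ij by (intro mult_left_mono r) auto
    then show ?thesis by (simp add: mult_ac)
  qed
  have "(\<Sum>S\<in>k_subsets V k. prod x S * (f S)\<^sup>2) \<le> down_up_form V x m f"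
    using down_up_gap[of V m x f] V k x mean unfolding m by simp
  then have "?N * (\<Sum>S\<in>k_subsets V k. prod x S * (f S)\<^sup>2) \<le> ?N * down_up_form V x m f"
    by (intro mult_left_mono) auto
  also have "\<dots> \<le> 2 * C\<^sup>2 * exchange_form V x k f"
    unfolding m exchange_form_Suc[OF V] down_up_form_def sum_distrib_left[where A = "k_subsets V m"]
  proof (rule sum_mono)
    fix T assume T: "T \<in> k_subsets V m"
    define a where "a = prod x T / (2 * sum x (V - T))"
    show "?N * (prod x T / (2 * sum x (V - T)) *
        (\<Sum>i\<in>V - T. \<Sum>j\<in>V - T. x i * x j * (f (insert i T) - f (insert j T))\<^sup>2)) \<le>
      2 * C\<^sup>2 * (\<Sum>i\<in>V - T. \<Sum>j\<in>V - T.
        prod x T * (x i * x j / (x i + x j)) * (f (insert i T) - f (insert j T))\<^sup>2)"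
      unfolding a_def[symmetric] unfolding sum_distrib_left
      unfolding a_def by (intro sum_mono * T)
  qed
  finally show ?thesis .
qed

text \<open>At high density pass to holes: their number is in the low-density range, and the bounds
  1 / C \<le> x \<le> C are invariant under inversion of x, so the constant is the same.\<close>

lemma exchange_form_ge:
  assumes V: "finite V" and k: "0 < k" "k < card V"
    and C: "\<And>i. i \<in> V \<Longrightarrow> x i \<le> C" "\<And>i. i \<in> V \<Longrightarrow> 1 / C \<le> x i" "C > 0"
    and mean: "(\<Sum>S\<in>k_subsets V k. prod x S * f S) = 0"
  shows "real (card V) * (\<Sum>S\<in>k_subsets V k. prod x S * (f S)\<^sup>2) \<le> 2 * C\<^sup>2 * exchange_form V x k f"
proof (cases "2 * k \<le> card V + 2")
  case True
  then show ?thesis using assms by (intro exchange_form_ge_low_density) auto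
next
  case False
  let ?y = "\<lambda>i. 1 / x i"
  let ?c = "card V - k"
  have x: "x i > 0" if "i \<in> V" for i
    using C(3) by (intro order.strict_trans2[OF _ C(2)[OF that]]) simp
  have P: "prod x V > 0" using x by (rule prod_pos)
  have compl: "(\<Sum>S\<in>k_subsets V k. prod x S * g S) = prod x V * (\<Sum>R\<in>k_subsets V ?c. prod ?y R * g (V - R))" for g
    unfolding sum_distrib_left
  proof (rule sum.reindex_bij_witness[of _ "\<lambda>R. V - R" "\<lambda>S. V - S"])
    fix S assume "S \<in> k_subsets V k"
    then have SV: "S \<subseteq> V" "card S = k" by (auto simp: k_subsets_def)
    then show "V - S \<in> k_subsets V ?c"
      using V by (auto simp: k_subsets_def card_Diff_subset finite_subset)
    show "V - (V - S) = S" using SV by auto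
    have "prod x V = prod x (V - S) * prod x S"
      using prod.subset_diff[OF SV(1) V] .
    moreover have "prod x (V - S) > 0" using x by (intro prod_pos) auto
    ultimately have "prod x V * prod ?y (V - S) = prod x S"
      by (simp add: prod_dividef)
    then show "prod x V * (prod ?y (V - S) * g (V - (V - S))) = prod x S * g S"
      unfolding \<open>V - (V - S) = S\<close> by simp
  next
    fix R assume R: "R \<in> k_subsets V ?c"
    then show "V - R \<in> k_subsets V k"
      using V k by (auto simp: k_subsets_def card_Diff_subset finite_subset)
  qed (auto simp: k_subsets_def)
  have "real (card V) * (\<Sum>R\<in>k_subsets V ?c. prod ?y R * (f (V - R))\<^sup>2) \<le>
      2 * C\<^sup>2 * exchange_form V ?y ?c (\<lambda>R. f (V - R))"
  proof (rule exchange_form_ge_low_density)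
    show "?y i \<le> C" "1 / C \<le> ?y i" if "i \<in> V" for i
      using C(1,2)[OF that] C(3) x[OF that] by (simp_all add: field_simps)
    show "(\<Sum>R\<in>k_subsets V ?c. prod ?y R * f (V - R)) = 0"
      using mean P unfolding compl by simp
  qed (use V k False C(3) in auto)
  then have "prod x V * (real (card V) * (\<Sum>R\<in>k_subsets V ?c. prod ?y R * (f (V - R))\<^sup>2)) \<le>
      prod x V * (2 * C\<^sup>2 * exchange_form V ?y ?c (\<lambda>R. f (V - R)))"
    using P by (intro mult_left_mono) auto
  also have "\<dots> = 2 * C\<^sup>2 * exchange_form V x k f"
    using exchange_form_complement[of V k x f] V k x by simp
  finally show ?thesis unfolding compl by (simp add: mult_ac)
qed


section \<open>From configurations to sets of occupied sites\<close>

lemma sum_config_space: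
  "(\<Sum>\<eta>\<in>config_space N w. F \<eta>) = (\<Sum>S\<in>k_subsets {1..N} w. F (\<lambda>i. i \<in> S))"
proof (rule sum.reindex_bij_witness[of _ "\<lambda>S i. i \<in> S" Collect])
  fix \<eta> assume "\<eta> \<in> config_space N w"
  then have \<eta>: "\<And>i. \<eta> i \<Longrightarrow> i \<in> {1..N}" "(\<Sum>i=1..N. of_bool (\<eta> i)) = w"
    by (auto simp: config_space_def PiE_dflt_def simp del: sum_of_bool_eq)
  then have "{1..N} \<inter> Collect \<eta> = Collect \<eta>" by auto
  with \<eta> show "Collect \<eta> \<in> k_subsets {1..N} w"
    by (auto simp: k_subsets_def)
next
  fix S assume "S \<in> k_subsets {1..N} w"
  then have S: "S \<subseteq> {1..N}" "card S = w" by (auto simp: k_subsets_def)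
  then have "{1..N} \<inter> S = S" by auto
  with S show "(\<lambda>i. i \<in> S) \<in> config_space N w"
    by (auto simp: config_space_def PiE_dflt_def)
qed auto

lemma sum_unordered_pairs:
  fixes b :: "nat \<Rightarrow> nat \<Rightarrow> real"
  assumes "\<And>i. b i i = 0"
  shows "(\<Sum>(i, j)\<in>{(i, j). 1 \<le> i \<and> i < j \<and> j \<le> N}. b i j + b j i) = (\<Sum>i=1..N. \<Sum>j=1..N. b i j)"
proof -
  let ?P = "{(i, j). 1 \<le> i \<and> i < j \<and> j \<le> N}" and ?Q = "{(i, j). 1 \<le> j \<and> j < i \<and> i \<le> N}"
  let ?D = "{(i, j). i = j \<and> 1 \<le> i \<and> i \<le> N}"
  have fin: "finite ?P" "finite ?Q" "finite ?D"
    by (rule finite_subset[of _ "{1..N} \<times> {1..N}"]; auto)+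
  have "(\<Sum>i=1..N. \<Sum>j=1..N. b i j) = (\<Sum>(i, j)\<in>{1..N} \<times> {1..N}. b i j)"
    by (simp add: sum.cartesian_product)
  also have "{1..N} \<times> {1..N} = (?P \<union> ?Q) \<union> ?D" by auto
  also have "(\<Sum>(i, j)\<in>(?P \<union> ?Q) \<union> ?D. b i j) = (\<Sum>(i, j)\<in>?P \<union> ?Q. b i j) + (\<Sum>(i, j)\<in>?D. b i j)"
    using fin by (intro sum.union_disjoint) auto
  also have "(\<Sum>(i, j)\<in>?P \<union> ?Q. b i j) = (\<Sum>(i, j)\<in>?P. b i j) + (\<Sum>(i, j)\<in>?Q. b i j)"
    using fin by (intro sum.union_disjoint) auto
  also have "(\<Sum>(i, j)\<in>?D. b i j) = 0"
    using assms by (intro sum.neutral) auto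
  also have "(\<Sum>(i, j)\<in>?Q. b i j) = (\<Sum>(i, j)\<in>?P. b j i)"
    by (rule sum.reindex_bij_witness[of _ prod.swap prod.swap]) auto
  finally show ?thesis by (simp add: sum.distrib case_prod_unfold)
qed

context
  fixes N w :: nat and p :: "nat \<Rightarrow> real"
  assumes w: "w \<le> N" and p: "\<And>i. i \<in> {1..N} \<Longrightarrow> 0 < p i \<and> p i < 1"
begin

text \<open>Factoring 1 - p i out of every site leaves p i / (1 - p i) on occupied sites only. The
  remaining constant, including the probability of \<open>config_space N w\<close>, is kept as an
  unspecified \<open>K\<close>, which will cancel in the Rayleigh quotient.\<close>

lemma expectation_cond_product:
  obtains K where "K > 0" "\<And>g. measure_pmf.expectation (cond_product N p w) g =
    K * (\<Sum>S\<in>k_subsets {1..N} w. (\<Prod>i\<in>S. p i / (1 - p i)) * g (\<lambda>i. i \<in> S))"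
proof
  let ?V = "{1..N}"
  let ?\<mu> = "Pi_pmf ?V False (\<lambda>i. bernoulli_pmf (p i))"
  let ?Z = "measure_pmf.prob ?\<mu> (config_space N w)"
  define K where "K = (\<Prod>i\<in>?V. 1 - p i) / ?Z"
  have ne: "set_pmf ?\<mu> \<inter> config_space N w \<noteq> {}"
    by (rule set_product_Int_config_space[OF w p])
  have "?Z > 0"
    using ne by (simp add: measure_pmf_posI ex_in_conv[symmetric] Bex_def) (meson measure_pmf_posI)
  then show "K > 0" unfolding K_def using p by (intro divide_pos_pos prod_pos) auto
  fix g :: "(nat \<Rightarrow> bool) \<Rightarrow> real"
  have "measure_pmf.expectation (cond_product N p w) g =
      (\<Sum>\<eta>\<in>config_space N w. pmf (cond_product N p w) \<eta> * g \<eta>)"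
    using set_cond_product[OF w p]
    by (subst integral_measure_pmf[OF finite_config_space[of N w]]) auto
  also have "\<dots> = (\<Sum>\<eta>\<in>config_space N w. K * ((\<Prod>i\<in>Collect \<eta>. p i / (1 - p i)) * g \<eta>))"
  proof (intro sum.cong refl)
    fix \<eta> assume \<eta>: "\<eta> \<in> config_space N w"
    then have out: "\<And>i. \<eta> i \<Longrightarrow> i \<in> ?V" by (auto simp: config_space_def PiE_dflt_def)
    have "pmf ?\<mu> \<eta> = (\<Prod>i\<in>?V. pmf (bernoulli_pmf (p i)) (\<eta> i))"
      using out by (intro pmf_Pi') auto
    also have "\<dots> = (\<Prod>i\<in>?V. (1 - p i) * (if \<eta> i then p i / (1 - p i) else 1))"
    proof (intro prod.cong refl)
      fix i assume "i \<in> ?V"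
      from p[OF this] show "pmf (bernoulli_pmf (p i)) (\<eta> i) = (1 - p i) * (if \<eta> i then p i / (1 - p i) else 1)"
        by auto
    qed
    also have "\<dots> = (\<Prod>i\<in>?V. 1 - p i) * (\<Prod>i\<in>{i\<in>?V. \<eta> i}. p i / (1 - p i))"
      by (simp only: prod.distrib prod.inter_filter[OF finite_atLeastAtMost])
    also have "{i\<in>?V. \<eta> i} = Collect \<eta>" using out by auto
    finally show "pmf (cond_product N p w) \<eta> * g \<eta> = K * ((\<Prod>i\<in>Collect \<eta>. p i / (1 - p i)) * g \<eta>)"
      unfolding cond_product_def pmf_cond[OF ne] K_def
      using \<eta> by simp
  qed
  finally show "measure_pmf.expectation (cond_product N p w) g =
    K * (\<Sum>S\<in>k_subsets ?V w. (\<Prod>i\<in>S. p i / (1 - p i)) * g (\<lambda>i. i \<in> S))"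
    by (simp add: sum_config_space sum_distrib_left)
qed

text \<open>Reversibility: detailed balance lets \<eta> and its exchange swap roles, and averaging
  the two expressions produces the square and the factor 1 / 2.\<close>

lemma expectation_exchange_symmetrize:
  assumes ij: "i \<in> {1..N}" "j \<in> {1..N}" "i \<noteq> j"
  shows "measure_pmf.expectation (cond_product N p w)
      (\<lambda>\<eta>. f \<eta> * (- (exchange_rate p i j \<eta> * (f (exchange i j \<eta>) - f \<eta>)))) =
    measure_pmf.expectation (cond_product N p w)
      (\<lambda>\<eta>. exchange_rate p i j \<eta> * (f (exchange i j \<eta>) - f \<eta>)\<^sup>2) / 2"
proof -
  let ?C = "config_space N w" and ?\<nu> = "pmf (cond_product N p w)"
  let ?c = "exchange_rate p i j" and ?e = "exchange i j"
  have E: "measure_pmf.expectation (cond_product N p w) g = (\<Sum>\<eta>\<in>?C. ?\<nu> \<eta> * g \<eta>)" for g :: "_ \<Rightarrow> real"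
    using set_cond_product[OF w p]
    by (subst integral_measure_pmf[OF finite_config_space[of N w]]) auto
  have "(\<Sum>\<eta>\<in>?C. ?\<nu> \<eta> * (f \<eta> * (- (?c \<eta> * (f (?e \<eta>) - f \<eta>))))) =
      (\<Sum>\<eta>\<in>?C. ?\<nu> \<eta> * ?c \<eta> * (f (?e \<eta>) * (f (?e \<eta>) - f \<eta>)))"
  proof (rule sum.reindex_bij_witness[of _ ?e ?e])
    fix \<eta> assume "\<eta> \<in> ?C"
    then show "?\<nu> (?e \<eta>) * ?c (?e \<eta>) * (f (?e (?e \<eta>)) * (f (?e (?e \<eta>)) - f (?e \<eta>))) =
        ?\<nu> \<eta> * (f \<eta> * (- (?c \<eta> * (f (?e \<eta>) - f \<eta>))))"
      using detailed_balance[OF w p ij] by (simp add: algebra_simps)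
  qed (use ij in \<open>auto intro!: exchange_in_config_space\<close>)
  moreover have "(\<Sum>\<eta>\<in>?C. ?\<nu> \<eta> * (f \<eta> * (- (?c \<eta> * (f (?e \<eta>) - f \<eta>))))) +
      (\<Sum>\<eta>\<in>?C. ?\<nu> \<eta> * ?c \<eta> * (f (?e \<eta>) * (f (?e \<eta>) - f \<eta>))) =
      (\<Sum>\<eta>\<in>?C. ?\<nu> \<eta> * (?c \<eta> * (f (?e \<eta>) - f \<eta>)\<^sup>2))"
    unfolding sum.distrib[symmetric] by (intro sum.cong refl) (simp add: power2_eq_square algebra_simps)
  ultimately show ?thesis unfolding E by simp
qed

text \<open>The rate vanishes unless exactly one of i and j is occupied, so the sum splits into
  jumps from i to j and jumps from j to i.\<close>

lemma sum_exchange_pair: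
  fixes f :: "(nat \<Rightarrow> bool) \<Rightarrow> real"
  assumes ij: "i \<in> {1..N}" "j \<in> {1..N}" "i \<noteq> j"
  defines "x \<equiv> \<lambda>i. p i / (1 - p i)"
  defines "b \<equiv> \<lambda>i j. \<Sum>S\<in>{S\<in>k_subsets {1..N} w. i \<in> S \<and> j \<notin> S}.
     prod x S * (x j / (x i + x j)) * (f (\<lambda>l. l \<in> insert j (S - {i})) - f (\<lambda>l. l \<in> S))\<^sup>2"
  shows "(\<Sum>S\<in>k_subsets {1..N} w. prod x S * (exchange_rate p i j (\<lambda>l. l \<in> S) *
      (f (exchange i j (\<lambda>l. l \<in> S)) - f (\<lambda>l. l \<in> S))\<^sup>2)) = b i j + b j i"
proof -
  let ?K = "k_subsets {1..N} w"
  let ?t = "\<lambda>i j S. prod x S * (x j / (x i + x j)) * (f (\<lambda>l. l \<in> insert j (S - {i})) - f (\<lambda>l. l \<in> S))\<^sup>2"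
  have rate: "p j * (1 - p i) / (p i * (1 - p j) + p j * (1 - p i)) = x j / (x i + x j)"
    if "i \<in> {1..N}" "j \<in> {1..N}" for i j
  proof -
    have d: "(1 - p i) * (1 - p j) \<noteq> 0" "p i \<noteq> 1" "p j \<noteq> 1"
      using p[OF that(1)] p[OF that(2)] by auto
    \<comment> \<open>Both numerator and denominator of the rate are divided by (1 - p i) (1 - p
      j).\<close>
    then have "x j = p j * (1 - p i) / ((1 - p i) * (1 - p j))"
      "x i + x j = (p i * (1 - p j) + p j * (1 - p i)) / ((1 - p i) * (1 - p j))"
      by (simp_all add: x_def add_divide_distrib)
    with d show ?thesis by (simp del: mult_eq_0_iff)
  qed
  have "prod x S * (exchange_rate p i j (\<lambda>l. l \<in> S) * (f (exchange i j (\<lambda>l. l \<in> S)) - f (\<lambda>l. l \<in> S))\<^sup>2) =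
      (if i \<in> S \<and> j \<notin> S then ?t i j S else 0) + (if j \<in> S \<and> i \<notin> S then ?t j i S else 0)" for S
  proof -
    consider "i \<in> S" "j \<notin> S" | "j \<in> S" "i \<notin> S" | "i \<in> S \<longleftrightarrow> j \<in> S" by auto
    then show ?thesis
    proof cases
      case 1
      then have "exchange i j (\<lambda>l. l \<in> S) = (\<lambda>l. l \<in> insert j (S - {i}))"
        using ij by (auto simp: exchange_def fun_eq_iff Transposition.transpose_def)
      with 1 show ?thesis using rate[OF ij(1,2)] by (simp add: exchange_rate_def)
    next
      case 2
      then have "exchange i j (\<lambda>l. l \<in> S) = (\<lambda>l. l \<in> insert i (S - {j}))"
        using ij by (auto simp: exchange_def fun_eq_iff Transposition.transpose_def)
      with 2 show ?thesis using rate[OF ij(2,1)] by (simp add: exchange_rate_def add.commute)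
    next
      case 3
      then show ?thesis by (auto simp: exchange_rate_def)
    qed
  qed
  then show ?thesis unfolding b_def by (simp only: sum.distrib sum.inter_filter finite_k_subsets finite_atLeastAtMost)
qed

lemma dirichlet_form_eq:
  obtains K where "K > 0"
    "\<And>g. measure_pmf.expectation (cond_product N p w) g =
      K * (\<Sum>S\<in>k_subsets {1..N} w. (\<Prod>i\<in>S. p i / (1 - p i)) * g (\<lambda>i. i \<in> S))"
    "\<And>f. measure_pmf.expectation (cond_product N p w) (\<lambda>\<eta>. f \<eta> * (- generator N p f \<eta>)) =
      K / (2 * real N) * exchange_form {1..N} (\<lambda>i. p i / (1 - p i)) w (\<lambda>S. f (\<lambda>i. i \<in> S))"
proof -
  let ?E = "measure_pmf.expectation (cond_product N p w)"
  let ?x = "\<lambda>i. p i / (1 - p i)"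
  let ?P = "{(i, j). 1 \<le> i \<and> i < j \<and> j \<le> N}"
  obtain K where K: "K > 0" "\<And>g. ?E g = K * (\<Sum>S\<in>k_subsets {1..N} w. prod ?x S * g (\<lambda>i. i \<in> S))"
    using expectation_cond_product by metis
  have "?E (\<lambda>\<eta>. f \<eta> * (- generator N p f \<eta>)) =
      K / (2 * real N) * exchange_form {1..N} ?x w (\<lambda>S. f (\<lambda>i. i \<in> S))" for f
  proof -
    define b where "b i j = (\<Sum>S\<in>{S\<in>k_subsets {1..N} w. i \<in> S \<and> j \<notin> S}. prod ?x S * (?x j / (?x i + ?x j)) *
      (f (\<lambda>l. l \<in> insert j (S - {i})) - f (\<lambda>l. l \<in> S))\<^sup>2)" for i j
    have pair: "?E (\<lambda>\<eta>. f \<eta> * (- (exchange_rate p i j \<eta> * (f (exchange i j \<eta>) - f \<eta>)))) = K / 2 * (b i j + b j i)"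
      if "(i, j) \<in> ?P" for i j
    proof -
      have ij: "i \<in> {1..N}" "j \<in> {1..N}" "i \<noteq> j" using that by auto
      show ?thesis
        unfolding expectation_exchange_symmetrize[OF ij] K(2) sum_exchange_pair[OF ij] b_def by simp
    qed
    have b0: "b i i = 0" for i
    proof -
      have "{S\<in>k_subsets {1..N} w. i \<in> S \<and> i \<notin> S} = {}" by auto
      then show ?thesis unfolding b_def by (simp only: sum.empty)
    qed
    have "?E (\<lambda>\<eta>. f \<eta> * (- generator N p f \<eta>)) = ?E (\<lambda>\<eta>. 1 / real N *
        (\<Sum>(i, j)\<in>?P. f \<eta> * (- (exchange_rate p i j \<eta> * (f (exchange i j \<eta>) - f \<eta>)))))"
      by (simp add: generator_def sum_distrib_left sum_negf case_prod_unfold mult_ac)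
    also have "\<dots> = 1 / real N * (\<Sum>(i, j)\<in>?P. ?E (\<lambda>\<eta>. f \<eta> * (- (exchange_rate p i j \<eta> * (f (exchange i j \<eta>) - f \<eta>)))))"
    proof -
      have int: "integrable (measure_pmf (cond_product N p w)) g" for g :: "_ \<Rightarrow> real"
        using set_cond_product[OF w p] by (intro integrable_measure_pmf_finite) (simp add: finite_config_space)
      show ?thesis
        by (simp only: integral_mult_right_zero case_prod_unfold Bochner_Integration.integral_sum[OF int])
    qed
    also have "(\<Sum>(i, j)\<in>?P. ?E (\<lambda>\<eta>. f \<eta> * (- (exchange_rate p i j \<eta> * (f (exchange i j \<eta>) - f \<eta>))))) =
        (\<Sum>(i, j)\<in>?P. K / 2 * (b i j + b j i))"
    proof (rule sum.cong[OF refl])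
      fix e assume "e \<in> ?P"
      then show "(case e of (i, j) \<Rightarrow> ?E (\<lambda>\<eta>. f \<eta> * (- (exchange_rate p i j \<eta> * (f (exchange i j \<eta>) - f \<eta>))))) =
          (case e of (i, j) \<Rightarrow> K / 2 * (b i j + b j i))"
        by (cases e) (simp only: prod.case pair)
    qed
    also have "\<dots> = K / 2 * (\<Sum>(i, j)\<in>?P. b i j + b j i)"
      by (simp only: sum_distrib_left case_prod_unfold)
    also have "(\<Sum>(i, j)\<in>?P. b i j + b j i) = exchange_form {1..N} ?x w (\<lambda>S. f (\<lambda>i. i \<in> S))"
      unfolding sum_unordered_pairs[of b N, OF b0] exchange_form_def
      by (rule sum.cong[OF refl], rule sum.cong[OF refl], rule b_def)
    finally show ?thesis by simp
  qed
  with K show ?thesis by (rule that)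
qed

end

section \<open>The uniform lower bound\<close>

text \<open>The weights lie between \<epsilon> and 1 / \<epsilon>, so the comparison applies with C
  = 1 / \<epsilon>. Its constant 2 / \<epsilon>^2 and the factor 1 / (2 N) of the Dirichlet form
  combine to \<epsilon>^2 / 4, the number of sites cancelling.\<close>

lemma spectral_gap_ge:
  assumes \<epsilon>: "\<epsilon> > 0" and w: "w \<le> N" and p: "\<And>i. i \<in> {1..N} \<Longrightarrow> \<epsilon> \<le> p i \<and> p i \<le> 1 - \<epsilon>"
  shows "spectral_gap N p w \<ge> ereal (\<epsilon>\<^sup>2 / 4)"
proof (cases "w = 0 \<or> w = N")
  case True
  then show ?thesis by (simp add: spectral_gap_def)
next
  case False
  let ?x = "\<lambda>i. p i / (1 - p i)"
  let ?E = "measure_pmf.expectation (cond_product N p w)"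
  have p01: "0 < p i \<and> p i < 1" if "i \<in> {1..N}" for i using p[OF that] \<epsilon> by auto
  obtain K where K: "K > 0" and
    E: "\<And>g. ?E g = K * (\<Sum>S\<in>k_subsets {1..N} w. prod ?x S * g (\<lambda>i. i \<in> S))" and
    L: "\<And>f. ?E (\<lambda>\<eta>. f \<eta> * (- generator N p f \<eta>)) =
      K / (2 * real N) * exchange_form {1..N} ?x w (\<lambda>S. f (\<lambda>i. i \<in> S))"
    by (rule dirichlet_form_eq[OF w p01]) (assumption, rule that)
  have gap: "\<epsilon>\<^sup>2 / 4 \<le> ?E (\<lambda>\<eta>. f \<eta> * (- generator N p f \<eta>)) / ?E (\<lambda>\<eta>. (f \<eta>)\<^sup>2)"
    if nz: "\<exists>\<eta>\<in>config_space N w. f \<eta> \<noteq> 0" and mean: "?E f = 0" for f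
  proof -
    let ?M = "\<Sum>S\<in>k_subsets {1..N} w. prod ?x S * (f (\<lambda>i. i \<in> S))\<^sup>2"
    let ?G = "exchange_form {1..N} ?x w (\<lambda>S. f (\<lambda>i. i \<in> S))"
    have N: "real N > 0" using False w by auto
    have "real (card {1..N}) * ?M \<le> 2 * (1 / \<epsilon>)\<^sup>2 * ?G"
    proof (rule exchange_form_ge)
      show "(\<Sum>S\<in>k_subsets {1..N} w. prod ?x S * f (\<lambda>i. i \<in> S)) = 0"
        using mean K unfolding E by simp
      fix i assume i: "i \<in> {1..N}"
      have "p i * \<epsilon> \<le> 1 * (1 - p i)" using p[OF i] p01[OF i] \<epsilon> by (intro mult_mono) auto
      then show "?x i \<le> 1 / \<epsilon>" using p01[OF i] \<epsilon> by (simp add: field_simps)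
      have "\<epsilon> * (1 - p i) \<le> p i * 1" using p[OF i] p01[OF i] \<epsilon> by (intro mult_mono) auto
      then show "1 / (1 / \<epsilon>) \<le> ?x i" using p01[OF i] \<epsilon> by (simp add: field_simps)
    qed (use False w \<epsilon> in auto)
    then have "\<epsilon>\<^sup>2 / 4 * ?M \<le> ?G / (2 * real N)"
      using N \<epsilon> by (simp add: field_simps power2_eq_square)
    then have "\<epsilon>\<^sup>2 / 4 * (K * ?M) \<le> K / (2 * real N) * ?G"
      using K mult_left_mono[of "\<epsilon>\<^sup>2 / 4 * ?M" "?G / (2 * real N)" K] by (simp add: mult_ac)
    then have le: "\<epsilon>\<^sup>2 / 4 * ?E (\<lambda>\<eta>. (f \<eta>)\<^sup>2) \<le> ?E (\<lambda>\<eta>. f \<eta> * (- generator N p f \<eta>))"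
      unfolding L by (simp only: E)
    obtain \<eta> where \<eta>: "\<eta> \<in> config_space N w" "f \<eta> \<noteq> 0" using nz by blast
    \<comment> \<open>The denominator is positive because \<nu> charges every configuration, in
      particular one where f is nonzero.\<close>
    have "?E (\<lambda>\<eta>. (f \<eta>)\<^sup>2) = (\<Sum>\<eta>\<in>config_space N w. pmf (cond_product N p w) \<eta> * (f \<eta>)\<^sup>2)"
      using set_cond_product[OF w p01]
      by (subst integral_measure_pmf[OF finite_config_space[of N w]]) auto
    also have "\<dots> > 0"
    proof (rule sum_pos2[OF finite_config_space \<eta>(1)])
      have "pmf (cond_product N p w) \<eta> > 0"
        using set_cond_product[OF w p01] \<eta>(1) by (intro pmf_positive) auto
      then show "0 < pmf (cond_product N p w) \<eta> * (f \<eta>)\<^sup>2" using \<eta>(2) by simp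
    qed auto
    finally show ?thesis using le by (simp only: pos_le_divide_eq)
  qed
  show ?thesis
    unfolding spectral_gap_def if_not_P[OF False]
  proof (rule Inf_greatest, elim CollectE exE conjE)
    fix e f
    assume e: "e = ereal (?E (\<lambda>\<eta>. f \<eta> * (- generator N p f \<eta>)) / ?E (\<lambda>\<eta>. (f \<eta>)\<^sup>2))"
      and f: "\<exists>\<eta>\<in>config_space N w. f \<eta> \<noteq> 0" "?E f = 0"
    show "ereal (\<epsilon>\<^sup>2 / 4) \<le> e"
      unfolding e ereal_less_eq using f by (rule gap)
  qed
qed

theorem theorem3p2:
  fixes \<epsilon> :: real
  assumes "\<epsilon> > 0"
  shows "\<exists>c::real. c > 0 \<and>
    (\<forall>N p. N \<ge> 2 \<longrightarrow> (\<forall>i\<in>{1..N}. \<epsilon> \<le> p i \<and> p i \<le> 1 - \<epsilon>) \<longrightarrow>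
      min_spectral_gap N p \<ge> ereal c)"
proof (intro exI[of _ "\<epsilon>\<^sup>2 / 4"] conjI allI impI)
  show "\<epsilon>\<^sup>2 / 4 > 0" using assms by simp
  fix N :: nat and p :: "nat \<Rightarrow> real"
  assume "\<forall>i\<in>{1..N}. \<epsilon> \<le> p i \<and> p i \<le> 1 - \<epsilon>"
  then have "ereal (\<epsilon>\<^sup>2 / 4) \<le> spectral_gap N p w" if "w \<in> {0..N}" for w
    using assms that by (intro spectral_gap_ge) auto
  then show "ereal (\<epsilon>\<^sup>2 / 4) \<le> min_spectral_gap N p"
    unfolding min_spectral_gap_def by (intro Min.boundedI) auto
qed

end
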